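(* If $G$ is a $C_4$-free graph with $\operatorname{mad}(G)\le\frac{30}{11}$, then $\chi_{so}(G)\le \Delta(G)+3$.
   Context: All graphs are finite and simple. A graph is $C_4$-free if it contains no cycle of length $4$ as a (not necessarily induced) subgraph. $\Delta(G)$ is the maximum degree of $G$, and $N_G(v)$ is the set of neighbors of $v$ in $G$. The maximum average degree $\operatorname{mad}(G)$ is the maximum of $\frac{2|E(H)|}{|V(H)|}$ over all non-empty subgraphs $H$ of $G$. For a positive integer $k$, a strong odd $k$-coloring of $G$ is a proper coloring of $G$ with colors in $\{1,\ldots,k\}$ (adjacent vertices receive different colors) such that for every non-isolated vertex $v$, if a color appears in $N_G(v)$, then it appears on an odd number of vertices of $N_G(v)$. The strong odd chromatic number $\chi_{so}(G)$ is the minimum $k$ such that $G$ has a strong odd $k$-coloring. *)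

theory Defs
  imports Complex_Main
begin

text \<open>A graph is given by a vertex set \<open>V\<close> and a set \<open>E\<close> of edges, an edge being the
  two-element set of its end points.\<close>

definition simple_graph :: "'a set \<Rightarrow> 'a set set \<Rightarrow> bool" where
  "simple_graph V E \<longleftrightarrow> finite V \<and> (\<forall>e\<in>E. e \<subseteq> V \<and> card e = 2)"

definition subgraph :: "'a set \<Rightarrow> 'a set set \<Rightarrow> 'a set \<Rightarrow> 'a set set \<Rightarrow> bool" where
  "subgraph W F V E \<longleftrightarrow> simple_graph W F \<and> W \<subseteq> V \<and> F \<subseteq> E"

definition nbrs :: "'a set \<Rightarrow> 'a set set \<Rightarrow> 'a \<Rightarrow> 'a set" where
  "nbrs V E v = {u \<in> V. {u, v} \<in> E}"

definition degree :: "'a set \<Rightarrow> 'a set set \<Rightarrow> 'a \<Rightarrow> nat" where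
  "degree V E v = card (nbrs V E v)"

text \<open>Inserting \<open>0\<close> into the sets of nonnegative numbers below only matters for the graph
  without vertices, for which maximum degree and maximum average degree become \<open>0\<close>.\<close>

definition max_degree :: "'a set \<Rightarrow> 'a set set \<Rightarrow> nat" where
  "max_degree V E = Max (insert 0 (degree V E ` V))"

definition mad :: "'a set \<Rightarrow> 'a set set \<Rightarrow> real" where
  "mad V E = Max (insert 0
     {2 * real (card F) / real (card W) | W F. subgraph W F V E \<and> W \<noteq> {}})"

definition C4_free :: "'a set \<Rightarrow> 'a set set \<Rightarrow> bool" where
  "C4_free V E \<longleftrightarrow>
     \<not> (\<exists>a\<in>V. \<exists>b\<in>V. \<exists>c\<in>V. \<exists>d\<in>V. distinct [a, b, c, d] \<and>
          {a, b} \<in> E \<and> {b, c} \<in> E \<and> {c, d} \<in> E \<and> {d, a} \<in> E)"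

definition proper_coloring :: "'a set \<Rightarrow> 'a set set \<Rightarrow> nat \<Rightarrow> ('a \<Rightarrow> nat) \<Rightarrow> bool" where
  "proper_coloring V E k f \<longleftrightarrow>
     f ` V \<subseteq> {1..k} \<and> (\<forall>u\<in>V. \<forall>v\<in>V. {u, v} \<in> E \<longrightarrow> f u \<noteq> f v)"

definition strong_odd_coloring :: "'a set \<Rightarrow> 'a set set \<Rightarrow> nat \<Rightarrow> ('a \<Rightarrow> nat) \<Rightarrow> bool" where
  "strong_odd_coloring V E k f \<longleftrightarrow>
     proper_coloring V E k f \<and>
     (\<forall>v\<in>V. nbrs V E v \<noteq> {} \<longrightarrow>
        (\<forall>i \<in> f ` nbrs V E v. odd (card {u \<in> nbrs V E v. f u = i})))"

definition strong_odd_chromatic_number :: "'a set \<Rightarrow> 'a set set \<Rightarrow> nat" where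
  "strong_odd_chromatic_number V E = (LEAST k. k > 0 \<and> (\<exists>f. strong_odd_coloring V E k f))"

end

theory Submission imports Defs begin

text \<open>
  Write \<open>D\<close> for the maximum degree. Every induced subgraph inherits \<open>C4\<close>-freeness, the degree bound and
  the bound 30/11 on average degrees, so it suffices to exclude a vertex set that is minimal among
  those inducing a graph without a strong odd colouring in \<open>D + 3\<close> colours. In such a critical graph
  any nonempty set \<open>S\<close> of vertices can be deleted, the rest coloured, and the colouring cannot be
  extended to \<open>S\<close>. A vertex \<open>w\<close> outside \<open>S\<close> is satisfied if its neighbours in \<open>S\<close> receive distinct
  colours unused on \<open>w\<close> and on its other neighbours, and there are at least two more such colours than
  there are neighbours of \<open>w\<close> in \<open>S\<close> (lemma \<open>card_free_ge\<close>). Hence vertices of degree at most 1,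
  adjacent 2-vertices, and triangles made of two 3-vertices and a 2-vertex cannot occur. Where greedy
  colouring falls short by one colour, the slack of the strong odd condition helps: the three
  neighbours of a 3-vertex may also share one colour, and so may three of the four neighbours of a
  4-vertex. In this way 3-vertices with two 2-neighbours and 4-vertices with four 2-neighbours are
  excluded; freeness from 4-cycles makes the second neighbours of these 2-vertices distinct.

  Call a 3-vertex bad if it has a 2-neighbour. The delicate step is that no bad vertex has two bad
  neighbours (\<open>no_bad_path\<close>); its colouring part is treated separately, for abstract colour lists, in
  the locale \<open>row_lists\<close>.

  Now give each vertex \<open>v\<close> the charge \<open>11 deg v - 30\<close>, let every vertex send 4 to each 2-neighbour,
  and let every vertex that is neither bad nor of degree 2 send 1 to each bad neighbour. All final
  charges are nonnegative, while the total is at most 0 because the average degree is at most 30/11.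
  So all final charges vanish, which determines the graph locally: the degrees are 2 and 3, each
  2-vertex has two bad neighbours, each bad vertex has exactly one bad neighbour, and each other
  3-vertex has three bad neighbours. Such a graph is coloured outright. The 2-vertices get one colour
  and the 3-vertices that are not bad another. The bad vertices use four colours, that is pairs of bits:
  the first bit is a proper 2-colouring of the union of two perfect matchings (bad neighbours, and
  pairs with a common 2-neighbour), the second one separates the three neighbours of each 3-vertex
  that is not bad, unless their first bits agree, in which case they share a colour. This uses
  \<open>6 \<le> D + 3\<close> colours, a contradiction (\<open>not_sparse\<close>).
\<close>

section \<open>Colour patterns on small neighbourhoods\<close>

definition odd_on :: "('a \<Rightarrow> nat) \<Rightarrow> 'a set \<Rightarrow> bool" where
  "odd_on g A \<longleftrightarrow> (\<forall>i\<in>g ` A. odd (card {u \<in> A. g u = i}))"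

text \<open>The two colour patterns that the strong odd condition permits on three vertices.\<close>

definition rainbow_or_constant :: "'c \<Rightarrow> 'c \<Rightarrow> 'c \<Rightarrow> bool" where
  "rainbow_or_constant p q r \<longleftrightarrow> (p \<noteq> q \<and> p \<noteq> r \<and> q \<noteq> r) \<or> (p = q \<and> q = r)"

lemma odd_on_inj: "inj_on g A \<Longrightarrow> odd_on g A"
proof -
  assume inj: "inj_on g A"
  have "{u \<in> A. g u = g v} = {v}" if "v \<in> A" for v
    using inj that by (auto dest: inj_onD)
  then show ?thesis by (auto simp: odd_on_def)
qed

lemma odd_on_constant:
  assumes "odd (card A)" and "\<And>u. u \<in> A \<Longrightarrow> g u = k"
  shows "odd_on g A"
proof -
  have "{u \<in> A. g u = k} = A" using assms(2) by auto
  then show ?thesis using assms by (auto simp: odd_on_def)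
qed

lemma odd_on_doubleton: "g p \<noteq> g q \<Longrightarrow> odd_on g {p, q}"
  by (rule odd_on_inj) (auto simp: inj_on_def)

lemma odd_on_triple:
  assumes "p \<noteq> q" "p \<noteq> r" "q \<noteq> r" and "rainbow_or_constant (g p) (g q) (g r)"
  shows "odd_on g {p, q, r}"
proof (cases "g p = g q")
  case True
  then have "g q = g r" using assms(4) by (auto simp: rainbow_or_constant_def)
  then show ?thesis using True assms(1-3) by (intro odd_on_constant[where k = "g p"]) auto
next
  case False
  then show ?thesis using assms(4)
    by (intro odd_on_inj) (auto simp: rainbow_or_constant_def inj_on_def)
qed

lemma odd_on_three_and_one:
  assumes "p \<noteq> q" "p \<noteq> r" "q \<noteq> r" "g p = g q" "g q = g r" "g s \<noteq> g r"
  shows "odd_on g {p, q, r, s}"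
proof -
  have "{u \<in> {p, q, r, s}. g u = g r} = {p, q, r}" "{u \<in> {p, q, r, s}. g u = g s} = {s}"
    using assms by auto
  then show ?thesis using assms by (auto simp: odd_on_def)
qed

lemma odd_on_cong: "(\<And>u. u \<in> A \<Longrightarrow> g u = h u) \<Longrightarrow> odd_on g A = odd_on h A"
proof -
  assume eq: "\<And>u. u \<in> A \<Longrightarrow> g u = h u"
  have "{u \<in> A. g u = i} = {u \<in> A. h u = i}" for i using eq by auto
  moreover have "g ` A = h ` A" using eq by (rule image_cong[OF refl])
  ultimately show ?thesis by (simp add: odd_on_def)
qed

section \<open>Choosing colours from lists\<close>

text \<open>The greedy step: \<open>xs\<close> lists the forbidden colours, repetitions allowed.\<close>

lemma pick_avoiding:
  assumes "length xs < card A"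
  obtains a where "a \<in> A" "a \<notin> set xs"
proof -
  have "\<not> A \<subseteq> set xs"
    using assms card_mono[of "set xs" A] card_length[of xs] by fastforce
  then show ?thesis using that by blast
qed

text \<open>The patterns on four vertices without a colour of even multiplicity: a rainbow, or three vertices
  of one colour and the fourth of another.\<close>

definition four_pattern :: "'c \<Rightarrow> 'c \<Rightarrow> 'c \<Rightarrow> 'c \<Rightarrow> bool" where
  "four_pattern a b c d \<longleftrightarrow>
     (a \<noteq> b \<and> a \<noteq> c \<and> a \<noteq> d \<and> b \<noteq> c \<and> b \<noteq> d \<and> c \<noteq> d) \<or>
     (a = b \<and> b = c \<and> d \<noteq> a) \<or> (a = b \<and> b = d \<and> c \<noteq> a) \<or>
     (a = c \<and> c = d \<and> b \<noteq> a) \<or> (b = c \<and> c = d \<and> a \<noteq> b)"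

definition four_choice :: "'c set \<Rightarrow> 'c set \<Rightarrow> 'c set \<Rightarrow> 'c set \<Rightarrow> bool" where
  "four_choice A B C D \<longleftrightarrow> (\<exists>a b c d. a \<in> A \<and> b \<in> B \<and> c \<in> C \<and> d \<in> D \<and> four_pattern a b c d)"

lemma four_choiceI:
  "a \<in> A \<Longrightarrow> b \<in> B \<Longrightarrow> c \<in> C \<Longrightarrow> d \<in> D \<Longrightarrow> four_pattern a b c d \<Longrightarrow> four_choice A B C D"
  unfolding four_choice_def by (intro exI conjI)

lemma four_choice_swap: "four_choice A C B D \<Longrightarrow> four_choice A B C D"
  "four_choice B A C D \<Longrightarrow> four_choice A B C D"
  unfolding four_choice_def
  by (elim exE conjE, rule exI, rule exI, rule exI, rule exI, intro conjI, assumption+, auto simp: four_pattern_def)+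

lemma pick_other:
  assumes "card A \<ge> 2" obtains a where "a \<in> A" "a \<noteq> p"
  using pick_avoiding[of "[p]" A] assms by auto

text \<open>A colour of one of the two different lists that is missing from the other one is chosen first; the
  remaining two colours are then found greedily.\<close>

lemma three_lists:
  assumes AB: "A \<noteq> B" and A: "card A \<ge> 2" and B: "card B \<ge> 2" and C: "card C \<ge> 2"
  obtains a b c where "a \<in> A" "b \<in> B" "c \<in> C" "a \<noteq> b" "a \<noteq> c" "b \<noteq> c"
proof (cases "A \<subseteq> B")
  case False
  then obtain a where a: "a \<in> A" "a \<notin> B" by blast
  obtain c where c: "c \<in> C" "c \<noteq> a" using pick_other[OF C] .
  obtain b where b: "b \<in> B" "b \<noteq> c" using pick_other[OF B] .
  show ?thesis using that[of a b c] a b c by auto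
next
  case True
  then obtain b where b: "b \<in> B" "b \<notin> A" using AB by blast
  obtain c where c: "c \<in> C" "c \<noteq> b" using pick_other[OF C] .
  obtain a where a: "a \<in> A" "a \<noteq> c" using pick_other[OF A] .
  show ?thesis using that[of a b c] a b c by auto
qed

text \<open>The fourth list contains the representatives \<open>a\<close> and \<open>b\<close> of the first two. A colour lying in three of
  the lists gives three equal entries. Otherwise \<open>a\<close> or \<open>b\<close> can be handed to the fourth list and be
  replaced in its own list by a new colour.\<close>

lemma four_lists_aux:
  assumes A: "card A \<ge> 2" and B: "card B \<ge> 2" and C: "card C \<ge> 2"
    and a: "a \<in> A" "a \<in> D" and b: "b \<in> B" "b \<in> D" and c: "c \<in> C"
    and ne: "a \<noteq> b" "a \<noteq> c" "b \<noteq> c"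
  shows "four_choice A B C D"
proof -
  obtain a' where a': "a' \<in> A" "a' \<noteq> a" using pick_other[OF A] .
  obtain b' where b': "b' \<in> B" "b' \<noteq> b" using pick_other[OF B] .
  obtain c1 where c1: "c1 \<in> C" "c1 \<noteq> a" using pick_other[OF C] .
  obtain c2 where c2: "c2 \<in> C" "c2 \<noteq> b" using pick_other[OF C] .
  obtain b1 where b1: "b1 \<in> B" "b1 \<noteq> a" using pick_other[OF B] .
  obtain a1 where a1: "a1 \<in> A" "a1 \<noteq> b" using pick_other[OF A] .
  consider "a \<in> B" | "a \<in> C" | "b \<in> A" | "b \<in> C" | "c \<in> A" "c \<in> B"
    | "b \<notin> A" "c \<notin> A" | "a \<notin> B" "c \<notin> B" by argo
  then show ?thesis
  proof cases
    case 1 show ?thesis by (rule four_choiceI[of a _ a _ c1 _ a]) (use 1 a c1 in \<open>auto simp: four_pattern_def\<close>)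
  next
    case 2 show ?thesis by (rule four_choiceI[of a _ b1 _ a _ a]) (use 2 a b1 in \<open>auto simp: four_pattern_def\<close>)
  next
    case 3 show ?thesis by (rule four_choiceI[of b _ b _ c2 _ b]) (use 3 b c2 in \<open>auto simp: four_pattern_def\<close>)
  next
    case 4 show ?thesis by (rule four_choiceI[of a1 _ b _ b _ b]) (use 4 b a1 in \<open>auto simp: four_pattern_def\<close>)
  next
    case 5 show ?thesis by (rule four_choiceI[of c _ c _ c _ a]) (use 5 c a ne in \<open>auto simp: four_pattern_def\<close>)
  next
    case 6
    then have "a' \<noteq> b" "a' \<noteq> c" using a' by auto
    then show ?thesis
      by (intro four_choiceI[of a' _ b _ c _ a]) (use a a' b c ne in \<open>auto simp: four_pattern_def\<close>)
  next
    case 7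
    then have "b' \<noteq> a" "b' \<noteq> c" using b' by auto
    then show ?thesis
      by (intro four_choiceI[of a _ b' _ c _ b]) (use a b b' c ne in \<open>auto simp: four_pattern_def\<close>)
  qed
qed

text \<open>Where distinct representatives fail, three of the lists share a colour.\<close>

lemma four_lists:
  assumes A: "card A \<ge> 2" and B: "card B \<ge> 2" and C: "card C \<ge> 2" and D: "card D \<ge> 2"
  shows "four_choice A B C D"
proof (cases "A = B \<and> B = C")
  case True
  obtain p where p: "p \<in> A" using A by fastforce
  obtain d where "d \<in> D" "d \<noteq> p" using pick_other[OF D] .
  then show ?thesis
    by (intro four_choiceI[of p _ p _ p _ d]) (use True p in \<open>auto simp: four_pattern_def\<close>)
next
  case False
  obtain a b c where abc: "a \<in> A" "b \<in> B" "c \<in> C" "a \<noteq> b" "a \<noteq> c" "b \<noteq> c"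
  proof (cases "A = B")
    case True
    then have "B \<noteq> C" using False by simp
    then show ?thesis using three_lists[OF _ B C A] that by metis
  next
    case False
    then show ?thesis using three_lists[OF _ A B C] that by metis
  qed
  obtain d where d: "d \<in> D" using D by fastforce
  obtain e where e: "e \<in> D" "e \<noteq> d" using pick_other[OF D] .
  have perm: "b \<noteq> a" "c \<noteq> a" "c \<noteq> b" using abc by auto
  consider "d \<notin> {a, b, c}" | "e \<notin> {a, b, c}" | "a \<in> D" "b \<in> D" | "a \<in> D" "c \<in> D" | "b \<in> D" "c \<in> D"
    using d e by auto
  then show ?thesis
  proof cases
    case 1 then show ?thesis
      by (intro four_choiceI[of a _ b _ c _ d]) (use d abc in \<open>auto simp: four_pattern_def\<close>)
  next
    case 2 then show ?thesis
      by (intro four_choiceI[of a _ b _ c _ e]) (use e abc in \<open>auto simp: four_pattern_def\<close>)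
  next
    case 3 show ?thesis by (rule four_lists_aux[OF A B C abc(1) 3(1) abc(2) 3(2) abc(3,4,5,6)])
  next
    case 4 show ?thesis
      by (rule four_choice_swap(1), rule four_lists_aux[OF A C B abc(1) 4(1) abc(3) 4(2) abc(2,5,4) perm(3)])
  next
    case 5 show ?thesis
      by (rule four_choice_swap(2), rule four_choice_swap(1), rule four_lists_aux[OF B C A abc(2) 5(1) abc(3) 5(2) abc(1,6) perm(1,2)])
  qed
qed

lemma rainbow_or_constant_swap: "rainbow_or_constant p q r \<Longrightarrow> rainbow_or_constant q p r"
  by (auto simp: rainbow_or_constant_def)

text \<open>Distinct representatives fail only if \<open>C\<close> has just the two colours chosen for \<open>F1\<close> and \<open>F2\<close>; then
  a second element of \<open>F1\<close> gives either a rainbow or three equal colours.\<close>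

lemma triple_choice:
  assumes F1: "card F1 \<ge> 2" and F2: "card F2 \<ge> 1" and C: "card C \<ge> 2"
  obtains p q r where "p \<in> F1" "q \<in> F2" "r \<in> C" "rainbow_or_constant p q r"
proof -
  obtain q where q: "q \<in> F2" using F2 by fastforce
  obtain p where p: "p \<in> F1" "p \<noteq> q" using pick_other[OF F1] .
  obtain p' where p': "p' \<in> F1" "p' \<noteq> p" using pick_other[OF F1] .
  obtain r where r: "r \<in> C" "r \<noteq> q" using pick_other[OF C] .
  obtain s where s: "s \<in> C" "s \<noteq> p" using pick_other[OF C] .
  consider "r \<noteq> p" | "s \<noteq> q" | "r = p" "s = q" "p' = q" | "r = p" "s = q" "p' \<noteq> q" by blast
  then show ?thesis
  proof cases
    case 1 then show ?thesis using that[of p q r] p q r by (auto simp: rainbow_or_constant_def)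
  next
    case 2 then show ?thesis using that[of p q s] p q s by (auto simp: rainbow_or_constant_def)
  next
    case 3 then show ?thesis using that[of q q q] p' q s by (auto simp: rainbow_or_constant_def)
  next
    case 4 then show ?thesis using that[of p' q p] p' q r by (auto simp: rainbow_or_constant_def)
  qed
qed

lemma two_subset:
  assumes "card A \<ge> 2" obtains B where "B \<subseteq> A" "card B = 2"
proof -
  obtain B where "B \<subseteq> A" "card B = 2" "finite B" by (rule obtain_subset_with_card_n[OF assms])
  then show ?thesis using that[of B] by simp
qed

lemma card_remove1: "card A \<ge> n + 1 \<Longrightarrow> card (A - {c}) \<ge> n"
  using diff_card_le_card_Diff[of "{c}" A] by simp

text \<open>The colour \<open>c\<close> of a central vertex has to leave one of the lists \<open>A1\<close>, \<open>A2\<close> untouched, so that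
  \<open>triple_choice\<close> applies to what remains. Together with \<open>x\<close> and the sets \<open>Z1\<close>, \<open>Z2\<close> this forbids
  only five colours, since each \<open>Z\<close> is a single colour or is absorbed by its list.\<close>

lemma center_choice:
  assumes K: "card K \<ge> 6" and A1: "card A1 = 2" and A2: "card A2 = 2" and C: "card C \<ge> 3"
    and Z1: "Z1 \<subseteq> {z1} \<or> Z1 \<subseteq> A1" and Z2: "Z2 \<subseteq> {z2} \<or> Z2 \<subseteq> A2"
  obtains c a1 a2 b where "c \<in> K" "c \<noteq> x" "c \<notin> Z1" "c \<notin> Z2"
    "a1 \<in> A1" "a1 \<noteq> c" "a2 \<in> A2" "a2 \<noteq> c" "b \<in> C" "b \<noteq> c" "rainbow_or_constant a1 a2 b"
proof -
  obtain p1 q1 where A1': "A1 = {p1, q1}" using A1 by (auto simp: card_2_iff)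
  obtain p2 q2 where A2': "A2 = {p2, q2}" using A2 by (auto simp: card_2_iff)
  have "\<exists>c. c \<in> K \<and> c \<noteq> x \<and> c \<notin> Z1 \<and> c \<notin> Z2 \<and> (c \<notin> A1 \<or> c \<notin> A2)"
  proof -
    consider "Z1 \<subseteq> {z1}" | "Z2 \<subseteq> {z2}" | "Z1 \<subseteq> A1" "Z2 \<subseteq> A2" using Z1 Z2 by blast
    then show ?thesis
    proof cases
      case 1
      obtain c where "c \<in> K" "c \<notin> set [x, z1, z2, p2, q2]"
        using pick_avoiding[of "[x, z1, z2, p2, q2]" K] K by auto
      then show ?thesis using 1 Z2 A2' by (intro exI[of _ c]) auto
    next
      case 2
      obtain c where "c \<in> K" "c \<notin> set [x, z1, z2, p1, q1]"
        using pick_avoiding[of "[x, z1, z2, p1, q1]" K] K by auto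
      then show ?thesis using 2 Z1 A1' by (intro exI[of _ c]) auto
    next
      case 3
      obtain c where "c \<in> K" "c \<notin> set [x, p1, q1, p2, q2]"
        using pick_avoiding[of "[x, p1, q1, p2, q2]" K] K by auto
      then show ?thesis using 3 A1' A2' by (intro exI[of _ c]) auto
    qed
  qed
  then obtain c where c: "c \<in> K" "c \<noteq> x" "c \<notin> Z1" "c \<notin> Z2" "c \<notin> A1 \<or> c \<notin> A2" by blast
  have r: "card (A1 - {c}) \<ge> 1" "card (A2 - {c}) \<ge> 1" "card (C - {c}) \<ge> 2"
    using A1 A2 C by (auto intro!: card_remove1)
  from c(5) show ?thesis
  proof
    assume "c \<notin> A1"
    then have "card (A1 - {c}) \<ge> 2" using A1 by simp
    then obtain p q r where "p \<in> A1 - {c}" "q \<in> A2 - {c}" "r \<in> C - {c}" "rainbow_or_constant p q r"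
      using triple_choice r by metis
    then show ?thesis using that[of c p q r] c by auto
  next
    assume "c \<notin> A2"
    then have "card (A2 - {c}) \<ge> 2" using A2 by simp
    then obtain p q r where "p \<in> A2 - {c}" "q \<in> A1 - {c}" "r \<in> C - {c}" "rainbow_or_constant p q r"
      using triple_choice r by metis
    then show ?thesis using that[of c q p r] c rainbow_or_constant_swap[of p q r] by auto
  qed
qed

lemma card_Diff_if:
  assumes "card A \<ge> n + of_bool e" and "e \<Longrightarrow> card R = 1"
  shows "card (A - (if e then R else {})) \<ge> n"
proof (cases e)
  case True
  then have "card R = 1" "finite R" using assms(2) card_ge_0_finite[of R] by simp_all
  then show ?thesis using diff_card_le_card_Diff[of R A] assms(1) True by simp
next
  case False
  then show ?thesis using assms(1) by simp
qed

lemma length_if: "length (if e then [b] else []) = of_bool e"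
  by simp

text \<open>In a branch of the configuration below a vertex \<open>v\<close> with colour list \<open>A\<close> is adjacent to a 2-vertex
  \<open>u\<close>, and \<open>R\<close> is a set of colours set aside for \<open>u\<close>: either one colour outside \<open>A\<close>, or all of \<open>A\<close>,
  in which case \<open>u\<close> takes the element of \<open>A\<close> that \<open>v\<close> does not.\<close>

definition reserved :: "'c set \<Rightarrow> 'c set \<Rightarrow> bool" where
  "reserved A R \<longleftrightarrow> card A = 2 \<and> ((\<exists>r. R = {r} \<and> r \<notin> A) \<or> R = A)"

text \<open>Removing one colour from \<open>A\<close> leaves fewer than two only if \<open>A\<close> has size 2 and contains that colour.\<close>

lemma reserve_removable:
  assumes A: "card A \<ge> 2" and P: "card P \<ge> 2"
  shows "(\<exists>r\<in>P. card (A - {r}) \<ge> 2) \<or> card A = 2 \<and> P = A"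
proof (cases "\<exists>r\<in>P. card (A - {r}) \<ge> 2")
  case False
  have sub: "P \<subseteq> A"
  proof
    fix r assume "r \<in> P"
    then have "card (A - {r}) < 2" using False by auto
    then show "r \<in> A" using A by (cases "r \<in> A") auto
  qed
  obtain r where r: "r \<in> P" using P by fastforce
  then have "\<not> card (A - {r}) \<ge> 2" using False by blast
  then have "card A = 2" using A card_remove1[of 2 A r] by linarith
  moreover have "finite A" using A by (auto intro: card_ge_0_finite)
  ultimately show ?thesis using card_seteq[OF \<open>finite A\<close> sub] P by simp
qed blast

lemma reserve:
  assumes A: "card A \<ge> 2" and P: "card P \<ge> 2"
  obtains A' R where "A' \<subseteq> A" "R \<subseteq> P" "reserved A' R" "card P \<ge> 3 \<longrightarrow> card R = 1"
proof (cases "\<exists>r\<in>P. card (A - {r}) \<ge> 2")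
  case True
  then obtain r where r: "r \<in> P" "card (A - {r}) \<ge> 2" by blast
  obtain A' where "A' \<subseteq> A - {r}" "card A' = 2" using two_subset[OF r(2)] .
  then show ?thesis using that[of A' "{r}"] r by (auto simp: reserved_def)
next
  case False
  then have "card A = 2" "P = A" using reserve_removable[OF A P] by blast+
  then show ?thesis using that[of A A] by (auto simp: reserved_def)
qed

text \<open>The colour \<open>c\<close> of the central vertex may coincide with the colour \<open>y\<close> of the third neighbour of \<open>v\<close>:
  then \<open>u\<close> is given that colour too and the neighbourhood of \<open>v\<close> is constant.\<close>

lemma reserved_color:
  assumes R: "reserved A R" and a: "a \<in> A" "a \<noteq> c" and c: "c \<notin> R" and y: "y \<notin> R"
  obtains b where "b \<in> R \<or> b = c \<and> c = y" "b \<noteq> a" "rainbow_or_constant c b y"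
proof (cases "c = y")
  case True
  then show ?thesis using that[of c] a by (simp add: rainbow_or_constant_def)
next
  case False
  obtain b where b: "b \<in> R" "b \<noteq> a"
  proof (cases "R = A")
    case True
    then show ?thesis using pick_other[of A] R that unfolding reserved_def by (metis order_refl)
  next
    case False
    then show ?thesis using R a that unfolding reserved_def by blast
  qed
  then have "b \<noteq> c" "b \<noteq> y" using c y by auto
  then show ?thesis using that[of b] b False by (simp add: rainbow_or_constant_def)
qed

section \<open>List colouring for a path of three bad vertices\<close>

text \<open>The situation to be solved: bad vertices \<open>v1 - v0 - v2\<close> with 2-neighbours \<open>u0\<close>, \<open>u1\<close>, \<open>u2\<close> are
  uncoloured. The further neighbours of \<open>v1\<close> and \<open>v2\<close> have colours \<open>y1\<close> and \<open>y2\<close>, the further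
  neighbour of \<open>u0\<close> has colour \<open>x\<close>. The lists are \<open>Q0\<close>, \<open>Q1\<close>, \<open>Q2\<close> for the \<open>u\<close>-vertices and \<open>A1\<close>,
  \<open>A2\<close> for \<open>v1\<close>, \<open>v2\<close>. Outer neighbours may coincide, which enlarges lists but creates additional
  conflicts: \<open>eij\<close> says that \<open>ui\<close> and \<open>uj\<close> have a common outer neighbour, \<open>hij\<close> that \<open>vi\<close> and \<open>uj\<close>
  have one. A common outer neighbour of two 2-vertices has degree at least 4, whence \<open>K7\<close>.

  Branch 1 consists of \<open>v1\<close> and \<open>u1\<close>. If \<open>y1\<close> is not in \<open>Q1\<close>, then \<open>Q1\<close> is so large that \<open>u1\<close> can be
  coloured last, and only the colour \<open>y1\<close> is forbidden for \<open>v0\<close>. Otherwise colours are reserved for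
  \<open>u1\<close>, and \<open>u1\<close> may moreover repeat the colour of \<open>v0\<close> if this is \<open>y1\<close>. In both cases the set of
  colours that the branch forbids for \<open>v0\<close> fits \<open>center_choice\<close>; only conflicting reservations for
  \<open>u1\<close> and \<open>u2\<close> need another argument.\<close>

locale row_lists =
  fixes K Q0 Q1 Q2 A1 A2 :: "nat set" and x y1 y2 :: nat and e01 e02 e12 h12 h21 :: bool
  assumes K: "card K \<ge> 6" and K7: "e12 \<Longrightarrow> card K \<ge> 7" and Q1_K: "Q1 \<subseteq> K" and Q2_K: "Q2 \<subseteq> K"
    and Q0: "card Q0 \<ge> 3 + of_bool e01 + of_bool e02"
    and Q1: "card Q1 \<ge> 3 + of_bool e01 + of_bool e12 + of_bool h21"
    and Q2: "card Q2 \<ge> 3 + of_bool e02 + of_bool e12 + of_bool h12"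
    and A1: "card A1 \<ge> 2 + of_bool h12" and A2: "card A2 \<ge> 2 + of_bool h21"
    and y1: "y1 \<notin> A1" and y2: "y2 \<notin> A2"
    and eh12: "e12 \<Longrightarrow> h12 \<Longrightarrow> y1 \<notin> Q1" and eh21: "e12 \<Longrightarrow> h21 \<Longrightarrow> y2 \<notin> Q2"
    and hh: "h12 \<Longrightarrow> h21 \<Longrightarrow> A1 = Q2 - {y2} \<and> A2 = Q1 - {y1}"
begin

lemma list_sizes:
  "card A1 \<ge> 2" "card A2 \<ge> 2" "card Q0 \<ge> 3"
  using A1 A2 Q0 by linarith+

lemma reduced_list_sizes:
  "card (Q1 - {y1}) \<ge> 2 + of_bool e01 + of_bool e12 + of_bool h21"
  "card (Q2 - {y2}) \<ge> 2 + of_bool e02 + of_bool e12 + of_bool h12"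
proof -
  show "card (Q1 - {y1}) \<ge> 2 + of_bool e01 + of_bool e12 + of_bool h21"
    by (rule card_remove1) (use Q1 in linarith)
  show "card (Q2 - {y2}) \<ge> 2 + of_bool e02 + of_bool e12 + of_bool h12"
    by (rule card_remove1) (use Q2 in linarith)
qed

text \<open>The colours are those of \<open>v0\<close>, \<open>v1\<close>, \<open>v2\<close>, \<open>u0\<close>, \<open>u1\<close>, \<open>u2\<close> in this order.\<close>

definition solution :: "nat \<Rightarrow> nat \<Rightarrow> nat \<Rightarrow> nat \<Rightarrow> nat \<Rightarrow> nat \<Rightarrow> bool" where
  "solution c a1 a2 b0 b1 b2 \<longleftrightarrow>
     c \<in> K \<and> c \<noteq> x \<and> a1 \<in> A1 \<and> a2 \<in> A2 \<and> b0 \<in> Q0 \<and> b1 \<in> Q1 \<and> b2 \<in> Q2 \<and>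
     a1 \<noteq> c \<and> a2 \<noteq> c \<and> b0 \<noteq> c \<and> b1 \<noteq> a1 \<and> b2 \<noteq> a2 \<and>
     rainbow_or_constant a1 a2 b0 \<and> rainbow_or_constant c b1 y1 \<and> rainbow_or_constant c b2 y2 \<and>
     (e01 \<longrightarrow> b0 \<noteq> b1) \<and> (e02 \<longrightarrow> b0 \<noteq> b2) \<and> (e12 \<longrightarrow> b1 \<noteq> b2) \<and>
     (h12 \<longrightarrow> a1 \<noteq> b2) \<and> (h21 \<longrightarrow> a2 \<noteq> b1)"

definition solvable :: bool where
  "solvable \<longleftrightarrow> (\<exists>c a1 a2 b0 b1 b2. solution c a1 a2 b0 b1 b2)"

lemma solvableI: "solution c a1 a2 b0 b1 b2 \<Longrightarrow> solvable"
  unfolding solvable_def by (intro exI)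

lemma swapped: "row_lists K Q0 Q2 Q1 A2 A1 y2 y1 e02 e01 e12 h21 h12"
proof (unfold_locales)
qed (use K K7 Q1_K Q2_K Q0 Q1 Q2 A1 A2 y1 y2 eh12 eh21 hh in simp_all)

lemma solvable_swapped:
  assumes "row_lists.solvable K Q0 Q2 Q1 A2 A1 x y2 y1 e02 e01 e12 h21 h12"
  shows solvable
proof -
  interpret s: row_lists K Q0 Q2 Q1 A2 A1 x y2 y1 e02 e01 e12 h21 h12 by (rule swapped)
  obtain c a2 a1 b0 b2 b1 where s: "s.solution c a2 a1 b0 b2 b1"
    using assms unfolding s.solvable_def by (elim exE)
  show ?thesis
    by (rule solvableI[of c a1 a2 b0 b1 b2])
      (use s rainbow_or_constant_swap[of a2 a1 b0] in \<open>auto simp: s.solution_def solution_def\<close>)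
qed

text \<open>The list \<open>Q1\<close> has one colour more than \<open>u1\<close> has conflicts, and the colour \<open>y1\<close> is excluded by the
  list itself.\<close>

lemma color_b1_last:
  assumes y: "y1 \<notin> Q1" and c: "c \<in> K" "c \<noteq> x" "c \<noteq> y1"
    and a: "a1 \<in> A1" "a1 \<noteq> c" "a2 \<in> A2" "a2 \<noteq> c" and b0: "b0 \<in> Q0" "b0 \<noteq> c"
    and roc: "rainbow_or_constant a1 a2 b0"
    and b2: "b2 \<in> Q2" "b2 \<noteq> a2" "rainbow_or_constant c b2 y2" "e02 \<Longrightarrow> b0 \<noteq> b2" "h12 \<Longrightarrow> a1 \<noteq> b2"
  shows solvable
proof -
  obtain b1 where b1: "b1 \<in> Q1" "b1 \<notin> set ([c, a1] @ (if e01 then [b0] else []) @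
      (if e12 then [b2] else []) @ (if h21 then [a2] else []))"
  proof (rule pick_avoiding)
    show "length ([c, a1] @ (if e01 then [b0] else []) @
      (if e12 then [b2] else []) @ (if h21 then [a2] else [])) < card Q1"
      using Q1 unfolding length_append length_if by simp
  qed
  then have "b1 \<noteq> c" "b1 \<noteq> y1" using y by auto
  then have "rainbow_or_constant c b1 y1" using c(3) by (simp add: rainbow_or_constant_def)
  then have "solution c a1 a2 b0 b1 b2"
    unfolding solution_def using assms b1 by auto
  then show ?thesis by (rule solvableI)
qed

lemma both_late:
  assumes "y1 \<notin> Q1" and y: "y2 \<notin> Q2"
  shows solvable
proof -
  obtain B1 where B1: "B1 \<subseteq> A1" "card B1 = 2" using two_subset[OF list_sizes(1)] .
  obtain B2 where B2: "B2 \<subseteq> A2" "card B2 = 2" using two_subset[OF list_sizes(2)] .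
  obtain c a1 a2 b0 where s: "c \<in> K" "c \<noteq> x" "c \<notin> {y1}" "c \<notin> {y2}" "a1 \<in> B1" "a1 \<noteq> c"
    "a2 \<in> B2" "a2 \<noteq> c" "b0 \<in> Q0" "b0 \<noteq> c" "rainbow_or_constant a1 a2 b0"
    using center_choice[OF K B1(2) B2(2) list_sizes(3), of "{y1}" y1 "{y2}" y2 x] by blast
  obtain b2 where b2: "b2 \<in> Q2" "b2 \<notin> set ([c, a2] @ (if e02 then [b0] else []) @ (if h12 then [a1] else []))"
  proof (rule pick_avoiding)
    show "length ([c, a2] @ (if e02 then [b0] else []) @ (if h12 then [a1] else [])) < card Q2"
      using Q2 unfolding length_append length_if by simp
  qed
  then have "b2 \<noteq> c" "b2 \<noteq> y2" using y by auto
  then have "rainbow_or_constant c b2 y2" using s(4) by (simp add: rainbow_or_constant_def)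
  then show ?thesis
    using color_b1_last[of c a1 a2 b0 b2] assms s b2 B1 B2 by (auto split: if_splits)
qed

text \<open>The colours for \<open>u2\<close> are reserved in advance, and removed from the lists of those vertices that
  conflict with \<open>u2\<close>; these lists have a spare colour for that purpose.\<close>

lemma one_late:
  assumes l: "y1 \<notin> Q1" and y: "y2 \<in> Q2"
  shows solvable
proof -
  have "card (Q2 - {y2}) \<ge> 2" using reduced_list_sizes(2) by linarith
  then obtain B2 R where R: "B2 \<subseteq> A2" "R \<subseteq> Q2 - {y2}" "reserved B2 R"
    and R1: "card (Q2 - {y2}) \<ge> 3 \<longrightarrow> card R = 1"
    by (rule reserve[OF list_sizes(2)])
  have R_single: "card R = 1" if "e02 \<or> h12"
    using R1 reduced_list_sizes(2) that by auto
  \<comment> \<open>The choice is meant for a singleton \<open>R\<close>; otherwise the second alternative holds.\<close>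
  have Z: "R \<subseteq> {SOME r. r \<in> R} \<or> R \<subseteq> B2" and B2: "card B2 = 2"
    using R(3) by (auto simp: reserved_def)
  have "card (A1 - (if h12 then R else {})) \<ge> 2"
    by (rule card_Diff_if) (use A1 R_single in simp_all)
  then obtain B1 where B1: "B1 \<subseteq> A1 - (if h12 then R else {})" "card B1 = 2" by (rule two_subset)
  have C: "card (Q0 - (if e02 then R else {})) \<ge> 3"
    by (rule card_Diff_if) (use Q0 R_single in simp_all)
  obtain c a1 a2 b0 where s: "c \<in> K" "c \<noteq> x" "c \<notin> {y1}" "c \<notin> R" "a1 \<in> B1" "a1 \<noteq> c"
    "a2 \<in> B2" "a2 \<noteq> c" "b0 \<in> Q0 - (if e02 then R else {})" "b0 \<noteq> c" "rainbow_or_constant a1 a2 b0"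
    using center_choice[OF K B1(2) B2 C, of "{y1}" y1 R "SOME r. r \<in> R" x] Z by blast
  have "y2 \<notin> R" using R(2) by blast
  then obtain b2 where b2: "b2 \<in> R \<or> b2 = c \<and> c = y2" "b2 \<noteq> a2" "rainbow_or_constant c b2 y2"
    using reserved_color[OF R(3) s(7,8,4)] by blast
  have "b2 \<in> Q2" using b2(1) R(2) y by auto
  moreover have "a1 \<in> A1" "a2 \<in> A2" "b0 \<in> Q0" using s(5,7,9) B1(1) R(1) by auto
  moreover have "b0 \<noteq> b2" if e02 using that b2(1) s(9,10) by auto
  moreover have "a1 \<noteq> b2" if h12 using that b2(1) s(5,6) B1(1) by auto
  ultimately show ?thesis
    using s(3) by (intro color_b1_last[OF l s(1,2) _ _ s(6) _ s(8) _ s(10,11) _ b2(2,3)]) auto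
qed

text \<open>Reserved colours that have been removed from all conflicting lists can be combined independently,
  and a branch that repeats the colour \<open>c\<close> of \<open>v0\<close> causes no new conflict, since every other vertex
  in question differs from \<open>c\<close>; the exception is a conflict between \<open>u1\<close> and \<open>u2\<close>.\<close>

lemma from_reservations:
  assumes y: "y1 \<in> Q1" "y2 \<in> Q2" and e: "\<not> e12"
    and R1: "B1 \<subseteq> A1" "R1 \<subseteq> Q1 - {y1}" "reserved B1 R1" "e01 \<Longrightarrow> card R1 = 1"
    and R2: "B2 \<subseteq> A2" "R2 \<subseteq> Q2 - {y2}" "reserved B2 R2" "e02 \<Longrightarrow> card R2 = 1"
    and h: "h12 \<Longrightarrow> B1 \<inter> R2 = {}" "h21 \<Longrightarrow> B2 \<inter> R1 = {}"
  shows solvable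
proof -
  have Z: "R1 \<subseteq> {SOME r. r \<in> R1} \<or> R1 \<subseteq> B1" "R2 \<subseteq> {SOME r. r \<in> R2} \<or> R2 \<subseteq> B2"
    and B: "card B1 = 2" "card B2 = 2"
    using R1(3) R2(3) by (auto simp: reserved_def)
  define S1 where "S1 = (if e01 then R1 else {})"
  define S2 where "S2 = (if e02 then R2 else {})"
  have "card (Q0 - S1) \<ge> 3 + of_bool e02"
    unfolding S1_def by (rule card_Diff_if) (use Q0 R1(4) in simp_all)
  then have C: "card (Q0 - S1 - S2) \<ge> 3"
    unfolding S2_def by (rule card_Diff_if) (rule R2(4))
  obtain c a1 a2 b0 where s: "c \<in> K" "c \<noteq> x" "c \<notin> R1" "c \<notin> R2" "a1 \<in> B1" "a1 \<noteq> c"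
    "a2 \<in> B2" "a2 \<noteq> c" "b0 \<in> Q0 - S1 - S2" "b0 \<noteq> c" "rainbow_or_constant a1 a2 b0"
    using center_choice[OF K B C Z, of x] by blast
  have "y1 \<notin> R1" "y2 \<notin> R2" using R1(2) R2(2) by auto
  obtain b1 where b1: "b1 \<in> R1 \<or> b1 = c \<and> c = y1" "b1 \<noteq> a1" "rainbow_or_constant c b1 y1"
    using reserved_color[OF R1(3) s(5,6,3) \<open>y1 \<notin> R1\<close>] .
  obtain b2 where b2: "b2 \<in> R2 \<or> b2 = c \<and> c = y2" "b2 \<noteq> a2" "rainbow_or_constant c b2 y2"
    using reserved_color[OF R2(3) s(7,8,4) \<open>y2 \<notin> R2\<close>] .
  have "b1 \<in> Q1" "b2 \<in> Q2" using b1(1) b2(1) R1(2) R2(2) y by auto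
  moreover have "e01 \<Longrightarrow> b0 \<noteq> b1" "e02 \<Longrightarrow> b0 \<noteq> b2" using b1(1) b2(1) s(9,10) by (auto simp: S1_def S2_def)
  moreover have "h12 \<Longrightarrow> a1 \<noteq> b2" "h21 \<Longrightarrow> a2 \<noteq> b1" using b1(1) b2(1) s(5-8) h by blast+
  moreover have "a1 \<in> A1" "a2 \<in> A2" "b0 \<in> Q0" using s(5,7,9) R1(1) R2(1) by auto
  ultimately have "solution c a1 a2 b0 b1 b2"
    unfolding solution_def using s(1,2,6,8,10,11) b1(2,3) b2(2,3) e by simp
  then show ?thesis by (rule solvableI)
qed

text \<open>The colours for \<open>u2\<close> are reserved first, as they may shrink \<open>A1\<close>; those for \<open>u1\<close> then have no
  influence on \<open>A2\<close>.\<close>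

lemma both_early_crossed_once:
  assumes y: "y1 \<in> Q1" "y2 \<in> Q2" and e: "\<not> e12" and h: "\<not> h21"
  shows solvable
proof -
  have cP: "card (Q1 - {y1}) \<ge> 2" "card (Q2 - {y2}) \<ge> 2" using reduced_list_sizes by linarith+
  obtain B2 R2 where R2: "B2 \<subseteq> A2" "R2 \<subseteq> Q2 - {y2}" "reserved B2 R2" "card (Q2 - {y2}) \<ge> 3 \<longrightarrow> card R2 = 1"
    using reserve[OF list_sizes(2) cP(2)] .
  have c2: "card R2 = 1" if "e02 \<or> h12" using that R2(4) reduced_list_sizes(2) by auto
  have "card (A1 - (if h12 then R2 else {})) \<ge> 2"
    by (rule card_Diff_if) (use A1 c2 in simp_all)
  then obtain B1 R1 where R1: "B1 \<subseteq> A1 - (if h12 then R2 else {})" "R1 \<subseteq> Q1 - {y1}" "reserved B1 R1"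
    "card (Q1 - {y1}) \<ge> 3 \<longrightarrow> card R1 = 1"
    by (rule reserve[OF _ cP(1)])
  have c1: "card R1 = 1" if e01 using that R1(4) reduced_list_sizes(1) by auto
  have B1: "B1 \<subseteq> A1" "h12 \<Longrightarrow> B1 \<inter> R2 = {}" using R1(1) by (auto split: if_splits)
  show ?thesis
    by (rule from_reservations[OF y e B1(1) R1(2,3) c1 R2(1-3)]) (use c2 h B1(2) in auto)
qed

text \<open>Here \<open>v1\<close> and \<open>u2\<close> have a common outer neighbour, and so have \<open>v2\<close> and \<open>u1\<close>. Hence \<open>A2\<close> is the
  list of \<open>u1\<close> without \<open>y1\<close>, and \<open>A1\<close> is the list of \<open>u2\<close> without \<open>y2\<close>. A common colour of both lists can be reserved for
  both 2-vertices at once, and if the lists are disjoint the reservations do not interfere.\<close>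

lemma both_early_crossed_twice:
  assumes y: "y1 \<in> Q1" "y2 \<in> Q2" and e: "\<not> e12" and h: "h12" "h21"
  shows solvable
proof -
  have A: "A1 = Q2 - {y2}" "A2 = Q1 - {y1}" using hh h by auto
  have c: "card A1 \<ge> 3" "card A2 \<ge> 3" using A1 A2 h by simp_all
  have "\<exists>r1\<in>A2. \<exists>r2\<in>A1. (r1 = r2 \<or> r1 \<notin> A1 \<and> r2 \<notin> A2)"
  proof (cases "A1 \<inter> A2 = {}")
    case True
    obtain r1 where "r1 \<in> A2" using c by fastforce
    moreover obtain r2 where "r2 \<in> A1" using c by fastforce
    ultimately show ?thesis using True by blast
  qed blast
  then obtain r1 r2 where r: "r1 \<in> A2" "r2 \<in> A1" "r1 = r2 \<or> r1 \<notin> A1 \<and> r2 \<notin> A2" by blast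
  have "card (A1 - {r2}) \<ge> 2" "card (A2 - {r1}) \<ge> 2" using c by (auto intro!: card_remove1)
  then obtain B1 B2 where B: "B1 \<subseteq> A1 - {r2}" "card B1 = 2" "B2 \<subseteq> A2 - {r1}" "card B2 = 2"
    using two_subset by metis
  have "reserved B1 {r1}" "reserved B2 {r2}" using B r(3) by (auto simp: reserved_def)
  then show ?thesis
    by (intro from_reservations[OF y e, of B1 "{r1}" B2 "{r2}"]) (use A B r in auto)
qed

text \<open>Giving \<open>v0\<close> the colour \<open>y1\<close> makes the neighbourhood of \<open>v1\<close> constant and costs nothing in \<open>A1\<close>,
  while \<open>u2\<close> is still free to differ from \<open>u1\<close>.\<close>

lemma both_early_shared_distinct:
  assumes y: "y1 \<in> Q1" "y2 \<in> Q2" and e: e12 and ne: "y1 \<noteq> y2" and x: "x \<noteq> y1"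
  shows solvable
proof -
  have h: "\<not> h12" "\<not> h21" using eh12 eh21 y e by auto
  have "card (A2 - {y1}) \<ge> 1" "card (Q0 - {y1}) \<ge> 2"
    using list_sizes(2,3) by (simp_all add: card_remove1)
  then obtain a1 a2 b0 where s: "a1 \<in> A1" "a2 \<in> A2 - {y1}" "b0 \<in> Q0 - {y1}" "rainbow_or_constant a1 a2 b0"
    using triple_choice[OF list_sizes(1), of "A2 - {y1}" "Q0 - {y1}"] by blast
  obtain b2 where b2: "b2 \<in> Q2" "b2 \<notin> set ([y1, y2, a2] @ (if e02 then [b0] else []))"
  proof (rule pick_avoiding)
    show "length ([y1, y2, a2] @ (if e02 then [b0] else [])) < card Q2"
      using Q2 e unfolding length_append length_if by simp
  qed
  have "rainbow_or_constant y1 y1 y1" "rainbow_or_constant y1 b2 y2"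
    using b2 ne by (auto simp: rainbow_or_constant_def)
  then have "solution y1 a1 a2 b0 y1 b2"
    unfolding solution_def using s b2 y y1 x h Q1_K by auto
  then show ?thesis by (rule solvableI)
qed

text \<open>If \<open>y1 = y2\<close>, the colour \<open>y1\<close> cannot be repeated on both 2-vertices, hence it is forbidden for \<open>v0\<close>;
  the seventh colour pays for this. Two different colours can be reserved for \<open>u1\<close> and \<open>u2\<close> unless
  \<open>A2\<close> and one further colour \<open>r1\<close> make up the list of \<open>u2\<close> without \<open>y2\<close>. In that case \<open>v0\<close> avoids this whole list,
  and no reservation is necessary.\<close>

lemma both_early_shared_equal:
  assumes y: "y1 \<in> Q1" "y2 \<in> Q2" and e: e12 and eq: "y1 = y2"
  shows solvable
proof -
  have h: "\<not> h12" "\<not> h21" using eh12 eh21 y e by auto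
  have cK: "card K \<ge> 7" using K7 e by simp
  have cP: "card (Q1 - {y1}) \<ge> 3 + of_bool e01" "card (Q2 - {y2}) \<ge> 3 + of_bool e02"
    using reduced_list_sizes e h by simp_all
  note cA = list_sizes(1,2)
  have "\<exists>r\<in>Q1 - {y1}. card (A1 - {r}) \<ge> 2"
    using reserve_removable[OF cA(1), of "Q1 - {y1}"] cP(1) by auto
  then obtain r1 where r1: "r1 \<in> Q1 - {y1}" "card (A1 - {r1}) \<ge> 2" by blast
  have cP2: "card (Q2 - {y2} - {r1}) \<ge> 2" by (rule card_remove1) (use cP(2) in simp)
  from reserve_removable[OF cA(2) cP2] show ?thesis
  proof
    assume "\<exists>r\<in>Q2 - {y2} - {r1}. card (A2 - {r}) \<ge> 2"
    then obtain r2 where r2: "r2 \<in> Q2 - {y2} - {r1}" "card (A2 - {r2}) \<ge> 2" by blast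
    obtain B1 where B1: "B1 \<subseteq> A1 - {r1}" "card B1 = 2" using two_subset[OF r1(2)] .
    then obtain p q where pq: "B1 = {p, q}" by (auto simp: card_2_iff)
    obtain c where c: "c \<in> K" "c \<notin> set [x, y1, r1, r2, p, q]"
      using pick_avoiding[of "[x, y1, r1, r2, p, q]" K] cK by auto
    define S1 where "S1 = (if e01 then {r1} else {})"
    define S2 where "S2 = (if e02 then {r2} else {})"
    have "card (Q0 - S1) \<ge> 3 + of_bool e02"
      unfolding S1_def by (rule card_Diff_if) (use Q0 in simp_all)
    then have "card (Q0 - S1 - S2) \<ge> 3"
      unfolding S2_def by (rule card_Diff_if) simp
    then have "card (Q0 - S1 - S2 - {c}) \<ge> 2" "card (A2 - {r2} - {c}) \<ge> 1"
      using r2(2) by (simp_all add: card_remove1)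
    moreover have "card B1 \<ge> 2" using B1 by simp
    ultimately obtain a1 a2 b0 where s: "a1 \<in> B1" "a2 \<in> A2 - {r2} - {c}" "b0 \<in> Q0 - S1 - S2 - {c}" "rainbow_or_constant a1 a2 b0"
      using triple_choice by metis
    have "rainbow_or_constant c r1 y1" "rainbow_or_constant c r2 y2"
      using r1(1) r2(1) c eq by (auto simp: rainbow_or_constant_def)
    moreover have "a1 \<in> A1" "a1 \<noteq> r1" "a1 \<noteq> c" using s(1) B1(1) pq c(2) by auto
    ultimately have "solution c a1 a2 b0 r1 r2"
      unfolding solution_def using s(2-4) r1(1) r2(1) c h by (auto simp: S1_def S2_def split: if_splits)
    then show ?thesis by (rule solvableI)
  next
    assume A2: "card A2 = 2 \<and> Q2 - {y2} - {r1} = A2"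
    have sub: "Q2 - {y2} \<subseteq> insert r1 A2" using A2 by blast
    obtain p q where pq: "A2 = {p, q}" using A2 by (auto simp: card_2_iff)
    have "card (Q2 - {y2}) \<le> 3"
      using card_mono[OF _ sub] card_insert_le_m1[of 3 A2 r1] A2 pq by auto
    then have e02: "\<not> e02" using cP(2) by auto
    \<comment> \<open>By \<open>sub\<close>, this makes \<open>c\<close> avoid the whole reduced list of \<open>u2\<close>.\<close>
    obtain c where c: "c \<in> K" "c \<notin> set [x, y1, r1, p, q]"
      using pick_avoiding[of "[x, y1, r1, p, q]" K] cK by auto
    have "card (A1 - {c}) \<ge> 1" "card (Q0 - {c}) \<ge> 2"
      using list_sizes(1,3) by (simp_all add: card_remove1)
    moreover have "card A2 \<ge> 2" using A2 by simp
    ultimately obtain a2 a1 b0 where s: "a2 \<in> A2" "a1 \<in> A1 - {c}" "b0 \<in> Q0 - {c}" "rainbow_or_constant a2 a1 b0"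
      using triple_choice by metis
    obtain b1 where b1: "b1 \<in> Q1 - {y1}" "b1 \<notin> set ([c, a1] @ (if e01 then [b0] else []))"
    proof (rule pick_avoiding)
      show "length ([c, a1] @ (if e01 then [b0] else [])) < card (Q1 - {y1})"
        using cP(1) unfolding length_append length_if by simp
    qed
    obtain b2 where b2: "b2 \<in> Q2 - {y2}" "b2 \<notin> set [a2, b1]"
      using pick_avoiding[of "[a2, b1]" "Q2 - {y2}"] cP(2) by auto
    have "b2 \<noteq> c" "a2 \<noteq> c" using b2(1) sub s(1) pq c(2) by auto
    then have "rainbow_or_constant c b1 y1" "rainbow_or_constant c b2 y2" "rainbow_or_constant a1 a2 b0"
      using b1 b2 c eq s(4) by (auto simp: rainbow_or_constant_def)
    then have "solution c a1 a2 b0 b1 b2"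
      unfolding solution_def using s(1-3) b1 b2 c h e02 \<open>a2 \<noteq> c\<close> by auto
    then show ?thesis by (rule solvableI)
  qed
qed

text \<open>The symmetry exchanging the two branches reduces the statement to the cases above.\<close>

theorem solvable: solvable
proof -
  interpret s: row_lists K Q0 Q2 Q1 A2 A1 x y2 y1 e02 e01 e12 h21 h12 by (rule swapped)
  consider "y1 \<notin> Q1" "y2 \<notin> Q2" | "y1 \<notin> Q1" "y2 \<in> Q2" | "y1 \<in> Q1" "y2 \<notin> Q2" | "y1 \<in> Q1" "y2 \<in> Q2" by blast
  then show ?thesis
  proof cases
    case 1 then show ?thesis by (rule both_late)
  next
    case 2 then show ?thesis by (rule one_late)
  next
    case 3 then show ?thesis by (intro solvable_swapped s.one_late)
  next
    case y: 4
    consider "\<not> e12" "\<not> h21" | "\<not> e12" "\<not> h12" | "\<not> e12" "h12" "h21"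
      | e12 "y1 = y2" | e12 "y1 \<noteq> y2" "x \<noteq> y1" | e12 "y2 \<noteq> y1" "x \<noteq> y2" by blast
    then show ?thesis
    proof cases
      case 1 then show ?thesis using both_early_crossed_once[OF y] by blast
    next
      case 2 then show ?thesis using solvable_swapped s.both_early_crossed_once[OF y(2,1)] by blast
    next
      case 3 then show ?thesis using both_early_crossed_twice[OF y] by blast
    next
      case 4 then show ?thesis using both_early_shared_equal[OF y] by blast
    next
      case 5 then show ?thesis using both_early_shared_distinct[OF y] by blast
    next
      case 6 then show ?thesis using solvable_swapped s.both_early_shared_distinct[OF y(2,1)] by blast
    qed
  qed
qed

end

section \<open>Minimal uncolourable graphs\<close>

lemma card3_obtain:
  assumes "card A = 3" "p \<in> A"
  obtains q r where "A = {p, q, r}" "p \<noteq> q" "p \<noteq> r" "q \<noteq> r"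
proof -
  have "card (A - {p}) = 2" using assms by simp
  then obtain q r where qr: "A - {p} = {q, r}" "q \<noteq> r" by (auto simp: card_2_iff)
  have A: "A = insert p {q, r}" using assms(2) qr(1) by (metis insert_Diff)
  have "p \<noteq> q" "p \<noteq> r" using qr(1) by blast+
  then show ?thesis using that[of q r] A qr(2) by simp
qed

lemma card2_obtain:
  assumes "card A = 2" "p \<in> A"
  obtains q where "A = {p, q}" "p \<noteq> q"
  using assms by (auto simp: card_2_iff)

text \<open>An induced subgraph is described by its vertex set alone, with \<open>E\<close> kept fixed; edges that leave the
  vertex set are invisible to all notions involved, so that passing to a subgraph only changes \<open>V\<close>.\<close>

locale critical_graph =
  fixes V :: "'a set" and E :: "'a set set" and D :: nat
  assumes finite_V: "finite V"
    and card_edge: "e \<in> E \<Longrightarrow> card e = 2"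
    and C4_free: "C4_free V E"
    and degree_le: "v \<in> V \<Longrightarrow> degree V E v \<le> D"
    and colorable_proper: "W \<subset> V \<Longrightarrow> \<exists>f. strong_odd_coloring W E (D + 3) f"
    and not_colorable: "\<not> strong_odd_coloring V E (D + 3) f"
begin

abbreviation N :: "'a \<Rightarrow> 'a set" where "N \<equiv> nbrs V E"
abbreviation deg :: "'a \<Rightarrow> nat" where "deg \<equiv> degree V E"
abbreviation colors :: "nat set" where "colors \<equiv> {1..D + 3}"

text \<open>The colours that a neighbour of \<open>w\<close> in \<open>S\<close> may receive when \<open>f\<close> colours the vertices outside \<open>S\<close>.\<close>

definition free :: "'a set \<Rightarrow> ('a \<Rightarrow> nat) \<Rightarrow> 'a \<Rightarrow> nat set" where
  "free S f w = colors - f ` (insert w (N w) - S)"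

lemma N_sub: "N v \<subseteq> V" by (auto simp: nbrs_def)
lemma finite_N [simp]: "finite (N v)" using finite_subset[OF N_sub finite_V] .
lemma N_V: "u \<in> N v \<Longrightarrow> u \<in> V" by (auto simp: nbrs_def)
lemma N_sym: "v \<in> V \<Longrightarrow> u \<in> N v \<Longrightarrow> v \<in> N u" by (auto simp: nbrs_def insert_commute)
lemma N_irrefl: "v \<notin> N v" using card_edge by (fastforce simp: nbrs_def)
lemma N_ne: "u \<in> N v \<Longrightarrow> u \<noteq> v" using N_irrefl by auto

lemma common_nbr_unique:
  assumes "u \<in> V" "w \<in> V" "u \<noteq> w" "p \<in> N u" "p \<in> N w" "q \<in> N u" "q \<in> N w"
  shows "p = q"
proof (rule ccontr)
  assume "p \<noteq> q"
  then have "distinct [u, p, w, q]" using assms N_ne by auto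
  moreover have "{u, p} \<in> E" "{p, w} \<in> E" "{w, q} \<in> E" "{q, u} \<in> E" "p \<in> V" "q \<in> V"
    using assms by (auto simp: nbrs_def insert_commute)
  ultimately show False using C4_free assms(1,2) unfolding C4_free_def by blast
qed

text \<open>Each vertex outside \<open>S\<close> among \<open>w\<close> and its neighbours blocks at most one of the \<open>D + 3\<close> colours.\<close>

lemma card_free:
  assumes "w \<in> V - S"
  shows "card (free S f w) + deg w \<ge> D + 2 + card (N w \<inter> S)"
proof -
  have "card (insert w (N w) - S) = Suc (card (N w - S))"
    using assms N_irrefl by (simp add: insert_Diff_if)
  moreover have "card (N w - S) + card (N w \<inter> S) = card (N w)"
    by (metis Diff_disjoint Int_Diff_Un Int_Diff_disjoint add.commute card_Un_disjoint finite_Diff finite_Int finite_N)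
  moreover have "card (f ` (insert w (N w) - S)) \<le> card (insert w (N w) - S)"
    by (rule card_image_le) simp
  moreover have "card (free S f w) \<ge> card colors - card (f ` (insert w (N w) - S))"
    unfolding free_def by (rule diff_card_le_card_Diff) simp
  ultimately show ?thesis by (simp add: degree_def)
qed

lemma card_free_ge: "w \<in> V - S \<Longrightarrow> card (free S f w) \<ge> 2 + card (N w \<inter> S)"
  using card_free[of w S f] degree_le[of w] by simp

lemma free_color: "a \<in> free S f w \<Longrightarrow> 1 \<le> a \<and> a \<le> D + 3"
  by (auto simp: free_def)

lemma free_ne: "a \<in> free S f w \<Longrightarrow> w \<notin> S \<Longrightarrow> a \<noteq> f w"
  by (auto simp: free_def)

text \<open>Sufficient conditions on \<open>h\<close> that only concern \<open>S\<close>: the new colours are distinct from each other and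
  from all old ones around every vertex outside \<open>S\<close>, so that the odd condition there is inherited,
  while it is demanded literally at the vertices of \<open>S\<close>.\<close>

definition extends :: "'a set \<Rightarrow> ('a \<Rightarrow> nat) \<Rightarrow> ('a \<Rightarrow> nat) \<Rightarrow> bool" where
  "extends S f h \<longleftrightarrow>
     (\<forall>w. w \<notin> S \<longrightarrow> h w = f w) \<and>
     (\<forall>s\<in>S. h s \<in> colors) \<and>
     (\<forall>s\<in>S. \<forall>w\<in>N s. w \<notin> S \<longrightarrow> h s \<in> free S f w) \<and>
     (\<forall>s\<in>S. \<forall>t\<in>N s. t \<in> S \<longrightarrow> h s \<noteq> h t) \<and>
     (\<forall>s\<in>S. \<forall>t\<in>S. \<forall>w\<in>N s. w \<notin> S \<longrightarrow> w \<in> N t \<longrightarrow> s \<noteq> t \<longrightarrow> h s \<noteq> h t) \<and>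
     (\<forall>s\<in>S. odd_on h (N s))"

text \<open>Criticality in the form in which it is used: the graph without \<open>S\<close> has a colouring \<open>f\<close>.\<close>

lemma no_extension:
  assumes "S \<subseteq> V" "S \<noteq> {}"
  obtains f where "\<And>h. \<not> extends S f h"
proof -
  have "V - S \<subset> V" using assms by auto
  then obtain f where f: "strong_odd_coloring (V - S) E (D + 3) f"
    using colorable_proper by blast
  have nb: "nbrs (V - S) E v = N v - S" for v by (auto simp: nbrs_def)
  have "\<not> extends S f h" for h
  proof
    assume ext: "extends S f h"
    have h: "h w = f w" if "w \<notin> S" for w using ext that by (simp add: extends_def)
    have col: "h s \<in> colors" if "s \<in> S" for s using ext that unfolding extends_def by blast
    have out: "h s \<in> free S f w" if "s \<in> S" "w \<in> N s" "w \<notin> S" for s w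
      using ext that unfolding extends_def by blast
    have inn: "h s \<noteq> h t" if "s \<in> S" "t \<in> S" "t \<in> N s" for s t
      using ext that unfolding extends_def by blast
    have two: "h s \<noteq> h t" if "s \<in> S" "t \<in> S" "s \<noteq> t" "\<not> N s \<inter> N t \<subseteq> S" for s t
      using ext that unfolding extends_def by blast
    have odd: "odd_on h (N s)" if "s \<in> S" for s using ext that by (simp add: extends_def)
    have io: "h s \<noteq> h w" if "s \<in> S" "w \<in> N s" for s w
      using that out[of s w] inn[of s w] h[of w] free_ne[of "h s" S f w] by (cases "w \<in> S") auto
    have "h u \<noteq> h v" if uv: "u \<in> V" "v \<in> V" "{u, v} \<in> E" for u v
    proof -
      have "u \<in> N v" "v \<in> N u" using uv by (auto simp: nbrs_def insert_commute)
      then consider "u \<in> S" | "v \<in> S" | "u \<in> V - S" "v \<in> V - S" using uv by auto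
      then show ?thesis
      proof cases
        case 3
        then have "f u \<noteq> f v" using f uv(3) unfolding strong_odd_coloring_def proper_coloring_def by blast
        then show ?thesis using h[of u] h[of v] 3 by simp
      next
        case 1 then show ?thesis using io[OF 1 \<open>v \<in> N u\<close>] by simp
      next
        case 2 then show ?thesis using io[OF 2 \<open>u \<in> N v\<close>] by simp
      qed
    qed
    moreover have "h ` V \<subseteq> colors"
    proof -
      have "f ` (V - S) \<subseteq> colors" using f unfolding strong_odd_coloring_def proper_coloring_def by auto
      then have fc: "f v \<in> colors" if "v \<in> V" "v \<notin> S" for v using that by blast
      have "h v \<in> colors" if "v \<in> V" for v
        using col[of v] h[of v] fc[of v] that by (cases "v \<in> S") simp_all
      then show ?thesis by blast
    qed
    moreover have "odd (card {u \<in> N v. h u = h w})" if v: "v \<in> V" "w \<in> N v" for v w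
    proof (cases "v \<in> S")
      case True then show ?thesis using odd v by (auto simp: odd_on_def)
    next
      case vS: False
      show ?thesis
      proof (cases "\<exists>s\<in>S. s \<in> N v \<and> h s = h w")
        case True
        then obtain s where s: "s \<in> S" "s \<in> N v" "h s = h w" by auto
        have vs: "v \<in> N s" using s v N_sym by auto
        have uniq: "t = s" if t: "t \<in> N v" "h t = h s" for t
        proof (rule ccontr)
          assume ne: "t \<noteq> s"
          have vt: "v \<in> N t" using t v N_sym by auto
          show False
          proof (cases "t \<in> S")
            case True then show False using two[of s t] s t ne vS vs vt by auto
          next
            case False
            have "h s \<in> free S f v" using out[of s v] s vs vS by simp
            then have "h s \<notin> f ` (insert v (N v) - S)" by (simp add: free_def)
            moreover have "h s = f t" using t(2) h[OF False] by simp
            moreover have "f t \<in> f ` (insert v (N v) - S)" using t(1) False by simp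
            ultimately show False by metis
          qed
        qed
        have "{u \<in> N v. h u = h w} = {s}"
        proof (intro equalityI subsetI)
          fix t assume "t \<in> {u \<in> N v. h u = h w}"
          then have "t \<in> N v" "h t = h s" using s(3) by auto
          then have "t = s" by (rule uniq)
          then show "t \<in> {s}" by blast
        next
          fix t assume "t \<in> {s}"
          then show "t \<in> {u \<in> N v. h u = h w}" using s(2,3) by blast
        qed
        then show ?thesis by simp
      next
        case False
        then have wS: "w \<in> N v - S" using v by auto
        have eq: "{u \<in> N v. h u = h w} = {u \<in> N v - S. f u = f w}"
          using False h wS by auto
        have "nbrs (V - S) E v \<noteq> {}" "f w \<in> f ` nbrs (V - S) E v" using wS by (auto simp: nb)
        then have "odd (card {u \<in> nbrs (V - S) E v. f u = f w})"
          using f v vS unfolding strong_odd_coloring_def by blast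
        then show ?thesis by (simp add: eq nb)
      qed
    qed
    ultimately have "strong_odd_coloring V E (D + 3) h"
      unfolding strong_odd_coloring_def proper_coloring_def by auto
    then show False using not_colorable by blast
  qed
  then show ?thesis by (rule that)
qed

section \<open>Reducible configurations\<close>

lemma card_free3: 
  assumes "w \<in> V" "w \<notin> S" "s \<in> N w" "s \<in> S" shows "card (free S f w) \<ge> 3"
proof -
  have "card {s} \<le> card (N w \<inter> S)" using assms by (intro card_mono) auto
  then show ?thesis using card_free_ge[of w S f] assms by auto
qed

lemma card_free4: 
  assumes "w \<in> V" "w \<notin> S" "s \<in> N w" "s \<in> S" "t \<in> N w" "t \<in> S" "s \<noteq> t"
  shows "card (free S f w) \<ge> 4"
proof -
  have "card {s, t} \<le> card (N w \<inter> S)" using assms by (intro card_mono) auto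
  then show ?thesis using card_free_ge[of w S f] assms by auto
qed

lemma deg2_obtain:
  assumes "u \<in> V" "deg u = 2" "v \<in> N u"
  obtains x where "N u = {v, x}" "v \<noteq> x" "x \<in> V" "x \<noteq> u" "u \<in> N x"
proof -
  obtain x where x: "N u = {v, x}" "v \<noteq> x"
    using card2_obtain[of "N u" v] assms by (auto simp: degree_def)
  then have "x \<in> N u" by simp
  then show ?thesis using that[of x] x N_V N_ne N_sym[OF assms(1)] by blast
qed

lemma deg3_obtain:
  assumes "v \<in> V" "deg v = 3" "p \<in> N v"
  obtains q r where "N v = {p, q, r}" "p \<noteq> q" "p \<noteq> r" "q \<noteq> r"
  using card3_obtain[of "N v" p] assms by (auto simp: degree_def)

lemma deg3_obtain_third:
  assumes "v \<in> V" "deg v = 3" "p \<in> N v" "q \<in> N v" "p \<noteq> q"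
  obtains r where "N v = {p, q, r}" "p \<noteq> r" "q \<noteq> r" "r \<in> V" "r \<noteq> v" "v \<in> N r"
proof -
  obtain s r where r: "N v = {p, s, r}" "p \<noteq> s" "p \<noteq> r" "s \<noteq> r" using deg3_obtain[OF assms(1-3)] .
  have "\<exists>r. N v = {p, q, r} \<and> p \<noteq> r \<and> q \<noteq> r"
  proof (cases "q = s")
    case True then show ?thesis using r by (intro exI[of _ r]) simp
  next
    case False
    then have "q = r" using assms(4,5) r(1) by simp
    then show ?thesis using r by (intro exI[of _ s]) (simp add: insert_commute)
  qed
  then obtain r where r: "N v = {p, q, r}" "p \<noteq> r" "q \<noteq> r" by (elim exE conjE)
  then have "r \<in> N v" by simp
  then show ?thesis using that[OF r] N_V N_ne N_sym[OF assms(1)] by simp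
qed

lemma min_degree: assumes v: "v \<in> V" shows "deg v \<ge> 2"
proof (rule ccontr)
  assume "\<not> deg v \<ge> 2"
  then have "card (N v) = 0 \<or> card (N v) = 1" unfolding degree_def by linarith
  then have w: "\<exists>w. N v \<subseteq> {w}" using card_1_singletonE[of "N v"] by (metis card_0_eq empty_subsetI finite_N order_refl)
  obtain f where f: "\<And>h. \<not> extends {v} f h"
    using no_extension[of "{v}"] v by blast
  have odd: "odd_on h (N v)" for h
    using w by (intro odd_on_inj) (auto simp: inj_on_def)
  obtain a where a: "a \<in> colors" "\<And>w. w \<in> N v \<Longrightarrow> a \<in> free {v} f w"
  proof (cases "N v = {}")
    case True then show ?thesis using that[of 1] by auto
  next
    case False
    then obtain w where Nv: "N v = {w}" using w by auto
    then have "w \<in> V - {v}" using N_V[of w v] N_ne[of w v] by auto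
    then have "card (free {v} f w) > 0" using card_free_ge[of w "{v}" f] by simp
    then obtain a where "a \<in> free {v} f w" by (auto simp: card_gt_0_iff)
    then show ?thesis using that[of a] Nv free_color by auto
  qed
  have "extends {v} f (f(v := a))"
    unfolding extends_def using a odd N_irrefl[of v] by auto
  then show False using f by blast
qed

lemma no_adjacent_2_vertices:
  assumes u: "u \<in> V" "deg u = 2" and x: "x \<in> N u"
  shows "deg x \<noteq> 2"
proof
  assume dx: "deg x = 2"
  have xV: "x \<in> V" and ux: "u \<in> N x" "u \<noteq> x" using N_V[OF x] N_sym[OF u(1) x] N_ne[OF x] by auto
  obtain y where y: "N u = {x, y}" "x \<noteq> y" "y \<in> V" "y \<noteq> u" "u \<in> N y"
    using deg2_obtain[OF u x] .
  obtain z where z: "N x = {u, z}" "u \<noteq> z" "z \<in> V" "z \<noteq> x" "x \<in> N z"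
    using deg2_obtain[OF xV dx ux(1)] .
  let ?S = "{u, x}"
  obtain f where f: "\<And>h. \<not> extends ?S f h" using no_extension[of ?S] u xV by blast
  have c: "card (free ?S f z) \<ge> 3" "card (free ?S f y) \<ge> 3"
    using card_free3[of z ?S x f] card_free3[of y ?S u f] y z by auto
  obtain a where a: "a \<in> free ?S f z" "a \<notin> set [f y]"
    using pick_avoiding[of "[f y]" "free ?S f z"] c by auto
  obtain b where b: "b \<in> free ?S f y" "b \<notin> set [f z, a]"
    using pick_avoiding[of "[f z, a]" "free ?S f y"] c by auto
  let ?h = "f(u := b, x := a)"
  have "odd_on ?h (N u)" "odd_on ?h (N x)"
    unfolding y(1) z(1) using a b y z ux by (auto intro!: odd_on_doubleton)
  then have "extends ?S f ?h"
    unfolding extends_def using a b ux y z by (auto dest: free_color)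
  then show False using f by blast
qed

text \<open>Delete \<open>v\<close> and both 2-neighbours. After colouring \<open>v\<close>, each 2-neighbour has a colour left, and these
  colours can be chosen distinct unless the colour of the third neighbour of \<open>v\<close> is available to both;
  then both take it. The 2-neighbours do not conflict elsewhere, since their other neighbours are
  distinct by \<open>C4\<close>-freeness.\<close>

lemma three_vertex_2_nbr_unique:
  assumes v: "v \<in> V" "deg v = 3"
    and u1: "u1 \<in> N v" "deg u1 = 2" and u2: "u2 \<in> N v" "deg u2 = 2"
  shows "u1 = u2"
proof (rule ccontr)
  assume ne: "u1 \<noteq> u2"
  obtain q r where qr: "N v = {u1, q, r}" "u1 \<noteq> q" "u1 \<noteq> r" "q \<noteq> r"
    using deg3_obtain[OF v u1(1)] .
  obtain y where y: "N v = {y, u1, u2}" "y \<noteq> u1" "y \<noteq> u2"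
    using qr ne u2(1) by auto
  have V: "u1 \<in> V" "u2 \<in> V" "y \<in> V" using y N_V[of _ v] by auto
  have vu: "v \<in> N u1" "v \<in> N u2" "v \<in> N y" "v \<noteq> u1" "v \<noteq> u2" "v \<noteq> y"
    using N_sym[OF v(1)] N_ne[of _ v] y by auto
  obtain x1 where x1: "N u1 = {v, x1}" "v \<noteq> x1" "x1 \<in> V" "x1 \<noteq> u1" "u1 \<in> N x1"
    using deg2_obtain[OF V(1) u1(2) vu(1)] .
  obtain x2 where x2: "N u2 = {v, x2}" "v \<noteq> x2" "x2 \<in> V" "x2 \<noteq> u2" "u2 \<in> N x2"
    using deg2_obtain[OF V(2) u2(2) vu(2)] .
  have x12: "x1 \<noteq> x2" using common_nbr_unique[of v x1 u1 u2] v x1 x2 u1 u2 ne by auto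
  have nu: "x1 \<noteq> u2" "x2 \<noteq> u1"
    using no_adjacent_2_vertices[OF V(1) u1(2), of u2] no_adjacent_2_vertices[OF V(2) u2(2), of u1]
      x1 x2 u1 u2 by auto
  let ?S = "{v, u1, u2}"
  obtain f where f: "\<And>h. \<not> extends ?S f h" using no_extension[of ?S] V v by blast
  have c: "card (free ?S f y) \<ge> 3" "card (free ?S f x1) \<ge> 3" "card (free ?S f x2) \<ge> 3"
    using card_free3[of y ?S v f] card_free3[of x1 ?S u1 f] card_free3[of x2 ?S u2 f] y x1 x2 V vu nu by auto
  obtain a where a: "a \<in> free ?S f y" "a \<notin> set [f x1, f x2]"
    using pick_avoiding[of "[f x1, f x2]" "free ?S f y"] c by auto
  have ay: "a \<noteq> f y" using free_ne[OF a(1)] y vu by auto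
  have ok: False if b: "b1 \<in> free ?S f x1" "b2 \<in> free ?S f x2" "b1 \<noteq> a" "b2 \<noteq> a"
    "rainbow_or_constant (f y) b1 b2" for b1 b2
  proof -
    let ?h = "f(v := a, u1 := b1, u2 := b2)"
    have "odd_on ?h (N u1)" "odd_on ?h (N u2)"
      unfolding x1(1) x2(1) using a x1 x2 vu nu by (auto intro!: odd_on_doubleton)
    moreover have "odd_on ?h (N v)"
      unfolding y(1) using y ne b(5) vu by (intro odd_on_triple) auto
    ultimately have "extends ?S f ?h"
      unfolding extends_def using a b x1 x2 y vu nu ne x12 by (auto dest: free_color)
    then show False using f by blast
  qed
  obtain b1 where b1: "b1 \<in> free ?S f x1" "b1 \<notin> set [f y, a]"
    using pick_avoiding[of "[f y, a]" "free ?S f x1"] c by auto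
  obtain b2 where b2: "b2 \<in> free ?S f x2" "b2 \<notin> set [f y, a]"
    using pick_avoiding[of "[f y, a]" "free ?S f x2"] c by auto
  show False
  proof (cases "f y \<in> free ?S f x1 \<and> f y \<in> free ?S f x2")
    case True
    then show False using ok[of "f y" "f y"] ay by (auto simp: rainbow_or_constant_def)
  next
    case False
    then consider "f y \<notin> free ?S f x1" | "f y \<notin> free ?S f x2" by blast
    then show False
    proof cases
      case 1
      obtain b where "b \<in> free ?S f x1" "b \<notin> set [b2, a]"
        using pick_avoiding[of "[b2, a]" "free ?S f x1"] c by auto
      then show False using ok[of b b2] b2 1 by (auto simp: rainbow_or_constant_def)
    next
      case 2
      obtain b where "b \<in> free ?S f x2" "b \<notin> set [b1, a]"
        using pick_avoiding[of "[b1, a]" "free ?S f x2"] c by auto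
      then show False using ok[of b1 b] b1 2 by (auto simp: rainbow_or_constant_def)
    qed
  qed
qed

text \<open>Delete \<open>v\<close> and its neighbours. Seven colours leave one for \<open>v\<close>, after which the four neighbours have
  lists of size 2 and \<open>four_lists\<close> applies.\<close>

lemma four_vertex_all_2_nbrs:
  assumes v: "v \<in> V" "deg v = 4" 
  shows "\<exists>u\<in>N v. deg u \<noteq> 2"
proof (rule ccontr)
  assume "\<not> (\<exists>u\<in>N v. deg u \<noteq> 2)"
  then have d2: "\<And>u. u \<in> N v \<Longrightarrow> deg u = 2" by blast
  have uV: "\<And>u. u \<in> N v \<Longrightarrow> u \<in> V \<and> v \<in> N u \<and> v \<noteq> u" using N_V N_sym[OF v(1)] N_ne by blast
  have "\<exists>x. N u = {v, x} \<and> v \<noteq> x \<and> x \<in> V \<and> x \<noteq> u \<and> u \<in> N x" if u: "u \<in> N v" for u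
  proof -
    have "u \<in> V" "v \<in> N u" using uV[OF u] by simp_all
    from deg2_obtain[OF this(1) d2[OF u] this(2)] obtain z where
      "N u = {v, z}" "v \<noteq> z" "z \<in> V" "z \<noteq> u" "u \<in> N z" .
    then show ?thesis by (intro exI[of _ z]) simp
  qed
  then have "\<forall>u. \<exists>x. u \<in> N v \<longrightarrow> N u = {v, x} \<and> v \<noteq> x \<and> x \<in> V \<and> x \<noteq> u \<and> u \<in> N x" by simp
  from choice[OF this] obtain x where
    x: "\<And>u. u \<in> N v \<Longrightarrow> N u = {v, x u} \<and> v \<noteq> x u \<and> x u \<in> V \<and> x u \<noteq> u \<and> u \<in> N (x u)"
    by blast
  have x_out: "x u \<notin> N v" if u: "u \<in> N v" for u
    using no_adjacent_2_vertices[of u "x u"] d2 u x[OF u] uV[OF u] by auto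
  have x_inj: "u = w" if u: "u \<in> N v" and w: "w \<in> N v" and eq: "x u = x w" for u w
    using common_nbr_unique[of v "x u" u w] v x[OF u] x[OF w] u w eq by auto
  let ?S = "insert v (N v)"
  obtain f where f: "\<And>h. \<not> extends ?S f h" using no_extension[of ?S] N_sub[of v] v by blast
  have cx: "card (free ?S f (x u)) \<ge> 3" if u: "u \<in> N v" for u
    using card_free3[of "x u" ?S u f] x[OF u] x_out[OF u] u by auto
  obtain u1 q where q: "N v = insert u1 q" "u1 \<notin> q" "card q = 3"
    using v(2) card_Suc_eq[of "N v" 3] by (auto simp: degree_def)
  obtain u2 u3 u4 where u: "q = {u2, u3, u4}" "u2 \<noteq> u3" "u2 \<noteq> u4" "u3 \<noteq> u4"
    using q(3) by (auto simp: card_3_iff)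
  have Nv: "N v = {u1, u2, u3, u4}" and une: "u1 \<noteq> u2" "u1 \<noteq> u3" "u1 \<noteq> u4" using q u by auto
  have "D \<ge> 4" using degree_le[OF v(1)] v(2) by simp
  then obtain a where a: "a \<in> colors" "a \<notin> set [f (x u1), f (x u2), f (x u3), f (x u4)]"
    using pick_avoiding[of "[f (x u1), f (x u2), f (x u3), f (x u4)]" colors] by auto
  have c2: "card (free ?S f (x u) - {a}) \<ge> 2" if "u \<in> N v" for u
  proof -
    have "card (free ?S f (x u)) - card {a} \<le> card (free ?S f (x u) - {a})"
      by (rule diff_card_le_card_Diff) simp
    then show ?thesis using cx[OF that] by simp
  qed
  have "four_choice (free ?S f (x u1) - {a}) (free ?S f (x u2) - {a}) (free ?S f (x u3) - {a}) (free ?S f (x u4) - {a})"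
    by (rule four_lists) (use c2 Nv in blast)+
  then obtain b1 b2 b3 b4 where b: "b1 \<in> free ?S f (x u1) - {a}" "b2 \<in> free ?S f (x u2) - {a}"
    "b3 \<in> free ?S f (x u3) - {a}" "b4 \<in> free ?S f (x u4) - {a}" "four_pattern b1 b2 b3 b4"
    unfolding four_choice_def by auto
  define h where "h = f(v := a, u1 := b1, u2 := b2, u3 := b3, u4 := b4)"
  have vne: "v \<noteq> u1" "v \<noteq> u2" "v \<noteq> u3" "v \<noteq> u4" using uV Nv by auto
  have h: "h v = a" "h u1 = b1" "h u2 = b2" "h u3 = b3" "h u4 = b4" "\<And>w. w \<notin> ?S \<Longrightarrow> h w = f w"
    using vne une u Nv by (auto simp: h_def)
  have hN: "h w \<in> free ?S f (x w) - {a}" if "w \<in> N v" for w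
  proof -
    have "w = u1 \<or> w = u2 \<or> w = u3 \<or> w = u4" using that Nv by simp
    then show ?thesis by (elim disjE) (use b(1-4) h(2-5) in simp_all)
  qed
  have hx: "h (x w) = f (x w)" "x w \<notin> ?S" if "w \<in> N v" for w
    using h(6)[of "x w"] x[OF that] x_out[OF that] by auto
  have oddv: "odd_on h (N v)"
  proof -
    have pat: "four_pattern (h u1) (h u2) (h u3) (h u4)" using b(5) h(2-5) by simp
    have perm: "{u1, u2, u3, u4} = {u1, u2, u4, u3}" "{u1, u2, u3, u4} = {u1, u3, u4, u2}"
      "{u1, u2, u3, u4} = {u2, u3, u4, u1}" by blast+
    show ?thesis
      using pat[unfolded four_pattern_def]
    proof (elim disjE)
      assume "h u1 \<noteq> h u2 \<and> h u1 \<noteq> h u3 \<and> h u1 \<noteq> h u4 \<and> h u2 \<noteq> h u3 \<and> h u2 \<noteq> h u4 \<and> h u3 \<noteq> h u4"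
      then have "inj_on h {u1, u2, u3, u4}" by (simp add: inj_on_def)
      then show ?thesis unfolding Nv by (rule odd_on_inj)
    next
      assume "h u1 = h u2 \<and> h u2 = h u3 \<and> h u4 \<noteq> h u1"
      then show ?thesis unfolding Nv using une u by (intro odd_on_three_and_one) simp_all
    next
      assume "h u1 = h u2 \<and> h u2 = h u4 \<and> h u3 \<noteq> h u1"
      then show ?thesis unfolding Nv perm(1) using une u by (intro odd_on_three_and_one) simp_all
    next
      assume "h u1 = h u3 \<and> h u3 = h u4 \<and> h u2 \<noteq> h u1"
      then show ?thesis unfolding Nv perm(2) using une u by (intro odd_on_three_and_one) simp_all
    next
      assume "h u2 = h u3 \<and> h u3 = h u4 \<and> h u1 \<noteq> h u2"
      then show ?thesis unfolding Nv perm(3) using une u by (intro odd_on_three_and_one) simp_all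
    qed
  qed
  have oddu: "odd_on h (N w)" if w: "w \<in> N v" for w
  proof -
    have "w = u1 \<or> w = u2 \<or> w = u3 \<or> w = u4" using w Nv by simp
    then have "a \<noteq> f (x w)" using a(2) by (elim disjE) simp_all
    then have "h v \<noteq> h (x w)" using hx[OF w] h(1) by simp
    then have "odd_on h {v, x w}" by (rule odd_on_doubleton)
    then show ?thesis using x[OF w] by simp
  qed
  have "extends ?S f h"
    unfolding extends_def
  proof (intro conjI ballI allI impI)
    fix w assume "w \<notin> ?S" then show "h w = f w" by (rule h(6))
  next
    fix s assume s: "s \<in> ?S"
    show "h s \<in> colors"
      using s a(1) h(1) hN[of s] free_color[of "h s" ?S f "x s"] by auto
    show "odd_on h (N s)" using s oddv oddu by auto
  next
    fix s w assume s: "s \<in> ?S" and w: "w \<in> N s" "w \<notin> ?S"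
    then have "s \<in> N v" by auto
    then show "h s \<in> free ?S f w" using x[of s] w hN[of s] by auto
  next
    fix s t assume s: "s \<in> ?S" and t: "t \<in> N s" "t \<in> ?S"
    have "s = v \<and> t \<in> N v \<or> s \<in> N v \<and> t = v"
      using s t x[of s] x_out[of s] N_irrefl[of v] by auto
    then show "h s \<noteq> h t" using hN[of s] hN[of t] h(1) by auto
  next
    fix s t w assume s: "s \<in> ?S" and t: "t \<in> ?S" and w: "w \<in> N s" "w \<notin> ?S" "w \<in> N t" and ne: "s \<noteq> t"
    have st: "s \<in> N v" "t \<in> N v" using s t w by auto
    then have "x s = x t" using w x[of s] x[of t] by auto
    then have "s = t" using x_inj st by blast
    then show "h s \<noteq> h t" using ne by simp
  qed
  then show False using f by blast
qed

text \<open>Delete the triangle. The 3-vertices are coloured greedily, and the 2-vertex has only four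
  forbidden colours, coming from the triangle and its two outer neighbours.\<close>

lemma no_triangle_with_2_vertex:
  assumes u: "u \<in> V" "deg u = 2" "v \<in> N u" "w \<in> N u" "w \<in> N v"
    and dv: "deg v = 3" and dw: "deg w = 3"
  shows False
proof -
  have V: "v \<in> V" "w \<in> V" using N_V[OF u(3)] N_V[OF u(4)] .
  have ne: "v \<noteq> u" "w \<noteq> u" "w \<noteq> v" using N_ne[OF u(3)] N_ne[OF u(4)] N_ne[OF u(5)] .
  have sy: "u \<in> N v" "u \<in> N w" "v \<in> N w"
    using N_sym[OF u(1,3)] N_sym[OF u(1,4)] N_sym[OF V(1) u(5)] .
  have Nu: "N u = {v, w}"
  proof -
    obtain z where z: "N u = {v, z}" "v \<noteq> z" using deg2_obtain[OF u(1-3)] .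
    then have "w = z" using u(4) ne by simp
    then show ?thesis using z by simp
  qed
  obtain a where Nv: "N v = {w, u, a}" "w \<noteq> a" "u \<noteq> a" and a: "a \<in> V" "a \<noteq> v" "v \<in> N a"
    using deg3_obtain_third[OF V(1) dv u(5) sy(1) ne(2)] .
  obtain b where Nw: "N w = {v, u, b}" "v \<noteq> b" "u \<noteq> b" and b: "b \<in> V" "b \<noteq> w" "w \<in> N b"
    using deg3_obtain_third[OF V(2) dw sy(3) sy(2) ne(1)] .
  have ab: "a \<noteq> b"
  proof
    assume "a = b"
    then have "a \<in> N v" "a \<in> N w" using Nv(1) Nw(1) by simp_all
    then show False using common_nbr_unique[OF V ne(3)[symmetric] _ _ sy(1,2)] Nv(3) by blast
  qed
  let ?S = "{v, w, u}"
  obtain f where f: "\<And>h. \<not> extends ?S f h" using no_extension[of ?S] V u by blast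
  have c: "card (free ?S f a) \<ge> 3" "card (free ?S f b) \<ge> 3"
    using card_free3[of a ?S v f] card_free3[of b ?S w f] a b Nv Nw by simp_all
  obtain cv where cv: "cv \<in> free ?S f a" "cv \<notin> set [f b]"
    using pick_avoiding[of "[f b]" "free ?S f a"] c by auto
  obtain cw where cw: "cw \<in> free ?S f b" "cw \<notin> set [f a, cv]"
    using pick_avoiding[of "[f a, cv]" "free ?S f b"] c by auto
  have "D \<ge> 3" using degree_le[OF V(1)] dv by simp
  then obtain cu where cu: "cu \<in> colors" "cu \<notin> set [cv, cw, f a, f b]"
    using pick_avoiding[of "[cv, cw, f a, f b]" colors] by auto
  let ?h = "f(v := cv, w := cw, u := cu)"
  have "odd_on ?h (N u)"
    unfolding Nu by (rule odd_on_doubleton) (use cw ne in simp)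
  moreover have "odd_on ?h (N v)"
    unfolding Nv(1)
  proof (rule odd_on_triple)
    show "rainbow_or_constant (?h w) (?h u) (?h a)"
      using cu cw ne Nv(2,3) a(2) by (simp add: rainbow_or_constant_def)
  qed (use ne Nv(2,3) in simp_all)
  moreover have "odd_on ?h (N w)"
    unfolding Nw(1)
  proof (rule odd_on_triple)
    show "rainbow_or_constant (?h v) (?h u) (?h b)"
      using cu cv ne Nw(2,3) b(2) by (simp add: rainbow_or_constant_def)
  qed (use ne Nw(2,3) in simp_all)
  ultimately have "extends ?S f ?h"
    unfolding extends_def
    using cu cv(1) cw Nu Nv Nw ne a(2) b(2) ab free_color[OF cv(1)] free_color[OF cw(1)]
    by simp
  then show False using f by blast
qed

lemma two_2_nbrs_degree:
  assumes w: "w \<in> V" and u: "u \<in> N w" "deg u = 2" and t: "t \<in> N w" "deg t = 2" and ne: "u \<noteq> t"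
  shows "deg w \<ge> 4"
proof -
  have "deg w \<noteq> 2" using no_adjacent_2_vertices[OF w _ u(1)] u(2) by blast
  moreover have "deg w \<noteq> 3" using three_vertex_2_nbr_unique[OF w _ u t] ne by blast
  ultimately show ?thesis using min_degree[OF w] by linarith
qed

text \<open>Delete two of the vertices and their 2-neighbours. As the third vertex \<open>v2\<close> stays coloured, it is
  enough that \<open>v0\<close> and \<open>v1\<close> do not use up the lists of \<open>u0\<close> and \<open>u1\<close>: two candidates \<open>p\<close>, \<open>q\<close> for
  \<open>u0\<close> and one candidate \<open>r\<close> for \<open>u1\<close> are kept available. If \<open>u0\<close> and \<open>u1\<close> have a common second
  neighbour, then \<open>D \<ge> 4\<close>, and the lists are longer by one.\<close>

lemma no_triangle_of_bad_vertices:
  assumes v: "v0 \<in> V" "deg v0 = 3" "v1 \<in> N v0" "deg v1 = 3" "v2 \<in> N v0" "deg v2 = 3" "v2 \<in> N v1"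
    and u0: "u0 \<in> N v0" "deg u0 = 2" and u1: "u1 \<in> N v1" "deg u1 = 2"
  shows False
proof -
  have V: "v1 \<in> V" "v2 \<in> V" "u0 \<in> V" "u1 \<in> V"
    using N_V[OF v(3)] N_V[OF v(5)] N_V[OF u0(1)] N_V[OF u1(1)] .
  have ne: "v1 \<noteq> v0" "v2 \<noteq> v0" "v2 \<noteq> v1" "u0 \<noteq> v0" "u1 \<noteq> v1" "u0 \<noteq> v1" "u0 \<noteq> v2" "u1 \<noteq> v0" "u1 \<noteq> v2"
    using N_ne[OF v(3)] N_ne[OF v(5)] N_ne[OF v(7)] N_ne[OF u0(1)] N_ne[OF u1(1)] v u0(2) u1(2) by auto
  have sy: "v0 \<in> N v1" "v0 \<in> N v2" "v1 \<in> N v2" "v0 \<in> N u0" "v1 \<in> N u1"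
    using N_sym[OF v(1) v(3)] N_sym[OF v(1) v(5)] N_sym[OF V(1) v(7)] N_sym[OF v(1) u0(1)] N_sym[OF V(1) u1(1)] .
  have uu: "u0 \<noteq> u1"
    using no_triangle_with_2_vertex[OF V(3) u0(2) sy(4) _ v(3) v(2) v(4)] sy(5) by blast
  have N0: "N v0 = {v1, v2, u0}"
  proof -
    obtain r where r: "N v0 = {v1, v2, r}" using deg3_obtain_third[OF v(1,2,3,5) ne(3)[symmetric]] .
    then show ?thesis using u0(1) ne by auto
  qed
  have N1: "N v1 = {v0, v2, u1}"
  proof -
    obtain r where r: "N v1 = {v0, v2, r}" using deg3_obtain_third[OF V(1) v(4) sy(1) v(7) ne(2)[symmetric]] .
    then show ?thesis using u1(1) ne by auto
  qed
  obtain x0 where x0: "N u0 = {v0, x0}" "v0 \<noteq> x0" "x0 \<in> V" "x0 \<noteq> u0" "u0 \<in> N x0"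
    using deg2_obtain[OF V(3) u0(2) sy(4)] .
  obtain x1 where x1: "N u1 = {v1, x1}" "v1 \<noteq> x1" "x1 \<in> V" "x1 \<noteq> u1" "u1 \<in> N x1"
    using deg2_obtain[OF V(4) u1(2) sy(5)] .
  have x0n: "x0 \<noteq> v1" "x0 \<noteq> u1" "x0 \<noteq> v2"
  proof -
    show "x0 \<noteq> v1" using x0(5) N1 ne uu by auto
    show "x0 \<noteq> u1" using no_adjacent_2_vertices[OF V(3) u0(2), of x0] x0(1) u1(2) by auto
    show "x0 \<noteq> v2" using no_triangle_with_2_vertex[OF V(3) u0(2) sy(4) _ v(5) v(2) v(6)] x0(1) by auto
  qed
  have x1n: "x1 \<noteq> v0" "x1 \<noteq> u0" "x1 \<noteq> v2"
  proof -
    show "x1 \<noteq> v0" using x1(5) N0 ne uu by auto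
    show "x1 \<noteq> u0" using no_adjacent_2_vertices[OF V(4) u1(2), of x1] x1(1) u0(2) by auto
    show "x1 \<noteq> v2" using no_triangle_with_2_vertex[OF V(4) u1(2) sy(5) _ v(7) v(4) v(6)] x1(1) by auto
  qed
  let ?S = "{v0, v1, u0, u1}"
  obtain f where f: "\<And>h. \<not> extends ?S f h" using no_extension[of ?S] V v(1) by blast
  have c0: "card (free ?S f x0) \<ge> 3"
    by (rule card_free3[of _ _ u0]) (use x0 x0n in simp_all)
  have c1: "card (free ?S f x1) \<ge> 3"
    by (rule card_free3[of _ _ u1]) (use x1 x1n in simp_all)
  have c2: "card (free ?S f v2) \<ge> 4"
    by (rule card_free4[of _ _ v0 v1]) (use V ne sy in simp_all)
  obtain a0 a1 b0 b1 where ab: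
    "a0 \<in> free ?S f v2" "a1 \<in> free ?S f v2" "a0 \<noteq> a1" "a0 \<noteq> f x0" "a1 \<noteq> f x1"
    "b0 \<in> free ?S f x0" "b1 \<in> free ?S f x1" "b0 \<notin> {f v2, a0, a1}" "b1 \<notin> {f v2, a0, a1}"
    "x0 = x1 \<Longrightarrow> b0 \<noteq> b1"
  proof (cases "x0 = x1")
    case False
    obtain p where p: "p \<in> free ?S f x0" "p \<notin> set [f v2]"
      using pick_avoiding[of "[f v2]" "free ?S f x0"] c0 by auto
    obtain q where q: "q \<in> free ?S f x0" "q \<notin> set [f v2, p]"
      using pick_avoiding[of "[f v2, p]" "free ?S f x0"] c0 by auto
    obtain a0 where a0: "a0 \<in> free ?S f v2" "a0 \<notin> set [f x0, p, q]"
      using pick_avoiding[of "[f x0, p, q]" "free ?S f v2"] c2 by auto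
    obtain r where r: "r \<in> free ?S f x1" "r \<notin> set [f v2, a0]"
      using pick_avoiding[of "[f v2, a0]" "free ?S f x1"] c1 by auto
    obtain a1 where a1: "a1 \<in> free ?S f v2" "a1 \<notin> set [f x1, a0, r]"
      using pick_avoiding[of "[f x1, a0, r]" "free ?S f v2"] c2 by auto
    show ?thesis
      by (rule that[of a0 a1 "if p = a1 then q else p" r]) (use p q a0 a1 r False in auto)
  next
    case True
    have "deg x0 \<ge> 4"
      using two_2_nbrs_degree[OF x0(3,5) u0(2) _ u1(2) uu] x1(5) True by simp
    then have "D \<ge> 4" using degree_le[OF x0(3)] by simp
    moreover have "card {v0, v1} \<le> card (N v2 \<inter> ?S)" using sy by (intro card_mono) auto
    ultimately have c2: "card (free ?S f v2) \<ge> 5"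
      using card_free[of v2 ?S f] v(6) V(2) ne by simp
    have c0: "card (free ?S f x0) \<ge> 4"
      by (rule card_free4[of _ _ u0 u1]) (use x0 x0n x1(5) True uu in simp_all)
    obtain p where p: "p \<in> free ?S f x0" "p \<notin> set [f v2]"
      using pick_avoiding[of "[f v2]" "free ?S f x0"] c0 by auto
    obtain q where q: "q \<in> free ?S f x0" "q \<notin> set [f v2, p]"
      using pick_avoiding[of "[f v2, p]" "free ?S f x0"] c0 by auto
    obtain r where r: "r \<in> free ?S f x0" "r \<notin> set [f v2, p, q]"
      using pick_avoiding[of "[f v2, p, q]" "free ?S f x0"] c0 by auto
    obtain a0 where a0: "a0 \<in> free ?S f v2" "a0 \<notin> set [f x0, p, q, r]"
      using pick_avoiding[of "[f x0, p, q, r]" "free ?S f v2"] c2 by auto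
    obtain a1 where a1: "a1 \<in> free ?S f v2" "a1 \<notin> set [f x1, a0, r]"
      using pick_avoiding[of "[f x1, a0, r]" "free ?S f v2"] c2 by auto
    show ?thesis
      by (rule that[of a0 a1 "if p = a1 then q else p" r]) (use p q a0 a1 r True in auto)
  qed
  have ab': "a0 \<noteq> b0" "a1 \<noteq> b1" "x0 = x1 \<Longrightarrow> b1 \<noteq> b0" using ab(8,9,10) by auto
  have an: "a0 \<noteq> f v2" "a1 \<noteq> f v2" using free_ne[OF ab(1)] free_ne[OF ab(2)] ne by auto
  let ?h = "f(v0 := a0, v1 := a1, u0 := b0, u1 := b1)"
  have "odd_on ?h (N u0)" unfolding x0(1)
    by (rule odd_on_doubleton) (use ab(4) ne uu x0(2,4) x0n in simp)
  moreover have "odd_on ?h (N u1)" unfolding x1(1)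
    by (rule odd_on_doubleton) (use ab(5) ne uu x1(2,4) x1n in simp)
  moreover have "odd_on ?h (N v0)" unfolding N0
  proof (rule odd_on_triple)
    show "rainbow_or_constant (?h v1) (?h v2) (?h u0)"
      using ab(8) an ne uu by (simp add: rainbow_or_constant_def)
  qed (use ne in simp_all)
  moreover have "odd_on ?h (N v1)" unfolding N1
  proof (rule odd_on_triple)
    show "rainbow_or_constant (?h v0) (?h v2) (?h u1)"
      using ab(9) an ne uu by (simp add: rainbow_or_constant_def)
  qed (use ne in simp_all)
  ultimately have "extends ?S f ?h"
    unfolding extends_def
    using ab ab' an ne uu x0(1,2,4) x1(1,2,4) x0n x1n N0 N1
      free_color[OF ab(1)] free_color[OF ab(2)] free_color[OF ab(6)] free_color[OF ab(7)]
    by simp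
  then show False using f by blast
qed

definition bad :: "'a \<Rightarrow> bool" where
  "bad v \<longleftrightarrow> v \<in> V \<and> deg v = 3 \<and> (\<exists>u\<in>N v. deg u = 2)"

lemma card_free_subset:
  assumes "w \<in> V" "w \<notin> S" "T \<subseteq> N w \<inter> S"
  shows "card (free S f w) \<ge> 2 + card T"
proof -
  have "card T \<le> card (N w \<inter> S)" by (rule card_mono) (use assms in simp_all)
  then show ?thesis using card_free_ge[of w S f] assms by simp
qed

text \<open>Delete the three bad vertices and their 2-neighbours and translate the situation into \<open>row_lists\<close>.
  The preceding lemmas and \<open>C4\<close>-freeness show that the six vertices are distinct, that their outer
  neighbours lie outside the deleted set, and that the only possible coincidences of outer neighbours
  are those accounted for in that locale.\<close>

lemma no_bad_path:
  assumes bad: "bad v0" "bad v1" "bad v2" and v1: "v1 \<in> N v0" and v2: "v2 \<in> N v0" and v12: "v1 \<noteq> v2"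
  shows False
proof -
  have V: "v0 \<in> V" "v1 \<in> V" "v2 \<in> V" and d: "deg v0 = 3" "deg v1 = 3" "deg v2 = 3"
    using bad unfolding bad_def by auto
  obtain u0 where u0: "u0 \<in> N v0" "deg u0 = 2" using bad(1) unfolding bad_def by blast
  obtain u1 where u1: "u1 \<in> N v1" "deg u1 = 2" using bad(2) unfolding bad_def by blast
  obtain u2 where u2: "u2 \<in> N v2" "deg u2 = 2" using bad(3) unfolding bad_def by blast
  have uV: "u0 \<in> V" "u1 \<in> V" "u2 \<in> V" using N_V[OF u0(1)] N_V[OF u1(1)] N_V[OF u2(1)] .
  have sy: "v0 \<in> N v1" "v0 \<in> N v2" "v0 \<in> N u0" "v1 \<in> N u1" "v2 \<in> N u2"
    using N_sym[OF V(1) v1] N_sym[OF V(1) v2] N_sym[OF V(1) u0(1)] N_sym[OF V(2) u1(1)] N_sym[OF V(3) u2(1)] .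
  have v_ne: "v1 \<noteq> v0" "v2 \<noteq> v0" "v2 \<noteq> v1" using N_ne[OF v1] N_ne[OF v2] v12 by simp_all
  have uv_ne: "u0 \<noteq> v0" "u0 \<noteq> v1" "u0 \<noteq> v2" "u1 \<noteq> v0" "u1 \<noteq> v1" "u1 \<noteq> v2" "u2 \<noteq> v0" "u2 \<noteq> v1" "u2 \<noteq> v2"
    using d u0(2) u1(2) u2(2) by auto
  have nadj: "v2 \<notin> N v1" "v1 \<notin> N v2"
    using no_triangle_of_bad_vertices[OF V(1) d(1) v1 d(2) v2 d(3) _ u0 u1]
      no_triangle_of_bad_vertices[OF V(1) d(1) v2 d(3) v1 d(2) _ u0 u2] by blast+
  have u_ne: "u0 \<noteq> u1" "u0 \<noteq> u2" "u1 \<noteq> u2"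
  proof -
    show "u0 \<noteq> u1"
      using no_triangle_with_2_vertex[OF uV(1) u0(2) sy(3) _ v1 d(1,2)] sy(4) by blast
    show "u0 \<noteq> u2"
      using no_triangle_with_2_vertex[OF uV(1) u0(2) sy(3) _ v2 d(1,3)] sy(5) by blast
    show "u1 \<noteq> u2"
      using common_nbr_unique[OF V(2,3) v12 sy(1,2) u1(1)] u2(1) uv_ne(4) by blast
  qed
  have N0: "N v0 = {v1, v2, u0}"
  proof -
    obtain r where r: "N v0 = {v1, v2, r}" using deg3_obtain_third[OF V(1) d(1) v1 v2 v12] .
    then show ?thesis using u0(1) uv_ne by auto
  qed
  obtain y1 where y1: "N v1 = {v0, u1, y1}" "v0 \<noteq> y1" "u1 \<noteq> y1" "y1 \<in> V" "y1 \<noteq> v1" "v1 \<in> N y1"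
    using deg3_obtain_third[OF V(2) d(2) sy(1) u1(1) uv_ne(4)[symmetric]] .
  obtain y2 where y2: "N v2 = {v0, u2, y2}" "v0 \<noteq> y2" "u2 \<noteq> y2" "y2 \<in> V" "y2 \<noteq> v2" "v2 \<in> N y2"
    using deg3_obtain_third[OF V(3) d(3) sy(2) u2(1) uv_ne(7)[symmetric]] .
  obtain x0 where x0: "N u0 = {v0, x0}" "v0 \<noteq> x0" "x0 \<in> V" "x0 \<noteq> u0" "u0 \<in> N x0"
    using deg2_obtain[OF uV(1) u0(2) sy(3)] .
  obtain x1 where x1: "N u1 = {v1, x1}" "v1 \<noteq> x1" "x1 \<in> V" "x1 \<noteq> u1" "u1 \<in> N x1"
    using deg2_obtain[OF uV(2) u1(2) sy(4)] .
  obtain x2 where x2: "N u2 = {v2, x2}" "v2 \<noteq> x2" "x2 \<in> V" "x2 \<noteq> u2" "u2 \<in> N x2"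
    using deg2_obtain[OF uV(3) u2(2) sy(5)] .
  have y_deg: "deg y1 \<noteq> 2" "deg y2 \<noteq> 2"
    using three_vertex_2_nbr_unique[OF V(2) d(2) u1, of y1] y1
      three_vertex_2_nbr_unique[OF V(3) d(3) u2, of y2] y2 by auto
  have x_deg: "deg x0 \<noteq> 2" "deg x1 \<noteq> 2" "deg x2 \<noteq> 2"
    using no_adjacent_2_vertices[OF uV(1) u0(2), of x0] no_adjacent_2_vertices[OF uV(2) u1(2), of x1]
      no_adjacent_2_vertices[OF uV(3) u2(2), of x2] x0(1) x1(1) x2(1) by simp_all
  have yu_ne: "y1 \<noteq> u0" "y1 \<noteq> u2" "y2 \<noteq> u0" "y2 \<noteq> u1" and xu_ne: "x0 \<noteq> u1" "x0 \<noteq> u2" "x1 \<noteq> u0" "x1 \<noteq> u2" "x2 \<noteq> u0" "x2 \<noteq> u1"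
    using y_deg x_deg u0(2) u1(2) u2(2) by auto
  have yv_ne: "y1 \<noteq> v2" "y2 \<noteq> v1" using nadj y1(1) y2(1) by auto
  have xv_ne: "x0 \<noteq> v1" "x0 \<noteq> v2" "x1 \<noteq> v0" "x1 \<noteq> v2" "x2 \<noteq> v0" "x2 \<noteq> v1"
  proof -
    have "u0 \<notin> N v1" "u0 \<notin> N v2" "u1 \<notin> N v0" "u1 \<notin> N v2" "u2 \<notin> N v0" "u2 \<notin> N v1"
      unfolding N0 y1(1) y2(1) using uv_ne u_ne yu_ne by auto
    then show "x0 \<noteq> v1" "x0 \<noteq> v2" "x1 \<noteq> v0" "x1 \<noteq> v2" "x2 \<noteq> v0" "x2 \<noteq> v1"
      using x0(5) x1(5) x2(5) by auto
  qed
  have y12: "y1 \<noteq> y2"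
    using common_nbr_unique[OF V(2,3) v12 sy(1,2), of y1] y1(1,2) y2(1) by auto
  have xy: "x0 \<noteq> y1" "x0 \<noteq> y2"
  proof -
    show "x0 \<noteq> y1" using common_nbr_unique[OF V(1) x0(3,2) v1 _ u0(1) x0(5)] y1(6) uv_ne by blast
    show "x0 \<noteq> y2" using common_nbr_unique[OF V(1) x0(3,2) v2 _ u0(1) x0(5)] y2(6) uv_ne by blast
  qed
  let ?S = "{v0, v1, v2, u0, u1, u2}"
  obtain f where f: "\<And>h. \<not> extends ?S f h" using no_extension[of ?S] V uV by blast
  have out: "x0 \<notin> ?S" "x1 \<notin> ?S" "x2 \<notin> ?S" "y1 \<notin> ?S" "y2 \<notin> ?S"
    using x0(2,4) x1(2,4) x2(2,4) y1(2,3,5) y2(2,3,5) xu_ne xv_ne yu_ne yv_ne by auto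
  let ?F = "free ?S f"
  have self: "f w \<notin> ?F w" if "w \<notin> ?S" for w using free_ne[OF _ that, of "f w"] by blast
  have Q0: "card (?F x0) \<ge> 3 + of_bool (x0 = x1) + of_bool (x0 = x2)"
  proof -
    have "card (?F x0) \<ge> 2 + card ({u0} \<union> (if x0 = x1 then {u1} else {}) \<union> (if x0 = x2 then {u2} else {}))"
      by (rule card_free_subset[OF x0(3) out(1)]) (use x0(5) x1(5) x2(5) in auto)
    then show ?thesis using u_ne by (simp split: if_splits)
  qed
  have Q1: "card (?F x1) \<ge> 3 + of_bool (x0 = x1) + of_bool (x1 = x2) + of_bool (y2 = x1)"
  proof -
    have "card (?F x1) \<ge> 2 + card ({u1} \<union> (if x0 = x1 then {u0} else {}) \<union> (if x1 = x2 then {u2} else {}) \<union> (if y2 = x1 then {v2} else {}))"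
      by (rule card_free_subset[OF x1(3) out(2)]) (use x0(5) x1(5) x2(5) y2(6) in auto)
    then show ?thesis using u_ne uv_ne by (simp split: if_splits)
  qed
  have Q2: "card (?F x2) \<ge> 3 + of_bool (x0 = x2) + of_bool (x1 = x2) + of_bool (y1 = x2)"
  proof -
    have "card (?F x2) \<ge> 2 + card ({u2} \<union> (if x0 = x2 then {u0} else {}) \<union> (if x1 = x2 then {u1} else {}) \<union> (if y1 = x2 then {v1} else {}))"
      by (rule card_free_subset[OF x2(3) out(3)]) (use x0(5) x1(5) x2(5) y1(6) in auto)
    then show ?thesis using u_ne uv_ne by (simp split: if_splits)
  qed
  have "card (?F y1) \<ge> 2 + card ({v1} \<union> (if y1 = x2 then {u2} else {}))"
    by (rule card_free_subset[OF y1(4) out(4)]) (use x2(5) y1(6) in auto)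
  then have A1: "card (?F y1 - {f x1}) \<ge> 2 + of_bool (y1 = x2)"
    using uv_ne by (intro card_remove1) (simp split: if_splits)
  have "card (?F y2) \<ge> 2 + card ({v2} \<union> (if y2 = x1 then {u1} else {}))"
    by (rule card_free_subset[OF y2(4) out(5)]) (use x1(5) y2(6) in auto)
  then have A2: "card (?F y2 - {f x2}) \<ge> 2 + of_bool (y2 = x1)"
    using uv_ne by (intro card_remove1) (simp split: if_splits)
  have D3: "D \<ge> 3" using degree_le[OF V(1)] d(1) by simp
  have D4: "D \<ge> 4" if "x1 = x2"
    using two_2_nbrs_degree[OF x1(3,5) u1(2) _ u2(2) u_ne(3)] x2(5) that degree_le[OF x1(3)] by simp
  interpret rl: row_lists colors "?F x0" "?F x1" "?F x2" "?F y1 - {f x1}" "?F y2 - {f x2}" "f x0" "f y1" "f y2"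
    "x0 = x1" "x0 = x2" "x1 = x2" "y1 = x2" "y2 = x1"
  proof (unfold_locales)
    show "?F x1 \<subseteq> colors" "?F x2 \<subseteq> colors" by (auto simp: free_def)
    show "f y1 \<notin> ?F y1 - {f x1}" "f y2 \<notin> ?F y2 - {f x2}" using self[OF out(4)] self[OF out(5)] by blast+
    show "f y1 \<notin> ?F x1" if "x1 = x2" "y1 = x2" using self[OF out(2)] that by simp
    show "f y2 \<notin> ?F x2" if "x1 = x2" "y2 = x1" using self[OF out(3)] that by simp
    show "?F y1 - {f x1} = ?F x2 - {f y2} \<and> ?F y2 - {f x2} = ?F x1 - {f y1}" if "y1 = x2" "y2 = x1"
      using that by simp
  qed (use D3 D4 Q0 Q1 Q2 A1 A2 in simp_all)
  from rl.solvable obtain c a1 a2 b0 b1 b2 where "rl.solution c a1 a2 b0 b1 b2"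
    unfolding rl.solvable_def by (elim exE)
  then have s: "c \<in> colors" "c \<noteq> f x0" "a1 \<in> ?F y1 - {f x1}" "a2 \<in> ?F y2 - {f x2}"
     "b0 \<in> ?F x0" "b1 \<in> ?F x1" "b2 \<in> ?F x2"
     "a1 \<noteq> c" "a2 \<noteq> c" "b0 \<noteq> c" "b1 \<noteq> a1" "b2 \<noteq> a2"
     "rainbow_or_constant a1 a2 b0" "rainbow_or_constant c b1 (f y1)" "rainbow_or_constant c b2 (f y2)"
     "x0 = x1 \<longrightarrow> b0 \<noteq> b1" "x0 = x2 \<longrightarrow> b0 \<noteq> b2" "x1 = x2 \<longrightarrow> b1 \<noteq> b2"
     "y1 = x2 \<longrightarrow> a1 \<noteq> b2" "y2 = x1 \<longrightarrow> a2 \<noteq> b1"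
    unfolding rl.solution_def by blast+
  have a: "a1 \<in> ?F y1" "a1 \<noteq> f x1" "a2 \<in> ?F y2" "a2 \<noteq> f x2" using s(3,4) by simp_all
  have sym: "c \<noteq> a1" "c \<noteq> a2" "c \<noteq> b0" "a1 \<noteq> b1" "a2 \<noteq> b2" "x0 = x1 \<longrightarrow> b1 \<noteq> b0" "x0 = x2 \<longrightarrow> b2 \<noteq> b0"
    "x1 = x2 \<longrightarrow> b2 \<noteq> b1" "y1 = x2 \<longrightarrow> b2 \<noteq> a1" "y2 = x1 \<longrightarrow> b1 \<noteq> a2"
    using s(8-12,16-20) by auto
  let ?h = "f(v0 := c, v1 := a1, v2 := a2, u0 := b0, u1 := b1, u2 := b2)"
  have hS: "?h v0 = c" "?h v1 = a1" "?h v2 = a2" "?h u0 = b0" "?h u1 = b1" "?h u2 = b2"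
    using v_ne uv_ne u_ne by simp_all
  have hout: "?h x0 = f x0" "?h x1 = f x1" "?h x2 = f x2" "?h y1 = f y1" "?h y2 = f y2"
    using out by simp_all
  have odd: "odd_on ?h (N v0)" "odd_on ?h (N v1)" "odd_on ?h (N v2)" "odd_on ?h (N u0)" "odd_on ?h (N u1)" "odd_on ?h (N u2)"
  proof -
    show "odd_on ?h (N v0)" unfolding N0
      by (rule odd_on_triple) (use v12 uv_ne s(13) in \<open>unfold hS, simp_all\<close>)
    show "odd_on ?h (N v1)" unfolding y1(1)
      by (rule odd_on_triple) (use uv_ne y1(2,3) s(14) in \<open>unfold hS hout, simp_all\<close>)
    show "odd_on ?h (N v2)" unfolding y2(1)
      by (rule odd_on_triple) (use uv_ne y2(2,3) s(15) in \<open>unfold hS hout, simp_all\<close>)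
    show "odd_on ?h (N u0)" unfolding x0(1)
      by (rule odd_on_doubleton) (use s(2) in \<open>unfold hS hout\<close>)
    show "odd_on ?h (N u1)" unfolding x1(1)
      by (rule odd_on_doubleton) (use a(2) in \<open>unfold hS hout\<close>)
    show "odd_on ?h (N u2)" unfolding x2(1)
      by (rule odd_on_doubleton) (use a(4) in \<open>unfold hS hout\<close>)
  qed
  have col: "a1 \<in> colors" "a2 \<in> colors" "b0 \<in> colors" "b1 \<in> colors" "b2 \<in> colors"
    using free_color[OF a(1)] free_color[OF a(3)] free_color[OF s(5)] free_color[OF s(6)] free_color[OF s(7)] by simp_all
  \<comment> \<open>Both orientations of every inequality, so that the simplifier settles the finite case distinction.\<close>
  note ne = v_ne v_ne[symmetric] uv_ne uv_ne[symmetric] u_ne u_ne[symmetric]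
  have "extends ?S f ?h"
    unfolding extends_def
  proof (intro conjI)
    show "\<forall>w. w \<notin> ?S \<longrightarrow> ?h w = f w" by simp
    show "\<forall>s\<in>?S. ?h s \<in> colors"
      using s(1) col hS by (simp del: fun_upd_apply)
    show "\<forall>s\<in>?S. \<forall>w\<in>N s. w \<notin> ?S \<longrightarrow> ?h s \<in> ?F w"
      using a s(5-7) hS by (simp add: N0 x0(1) x1(1) x2(1) y1(1) y2(1) del: fun_upd_apply)
    show "\<forall>s\<in>?S. \<forall>t\<in>N s. t \<in> ?S \<longrightarrow> ?h s \<noteq> ?h t"
      using s(8-12) sym ne out hS by (simp add: N0 x0(1) x1(1) x2(1) y1(1) y2(1) del: fun_upd_apply)
    show "\<forall>s\<in>?S. \<forall>t\<in>?S. \<forall>w\<in>N s. w \<notin> ?S \<longrightarrow> w \<in> N t \<longrightarrow> s \<noteq> t \<longrightarrow> ?h s \<noteq> ?h t"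
      using s(8-12,16-20) sym ne out hS xy xy[symmetric] y12 y12[symmetric] by (simp add: N0 x0(1) x1(1) x2(1) y1(1) y2(1) del: fun_upd_apply)
    show "\<forall>s\<in>?S. odd_on ?h (N s)" using odd by (simp del: fun_upd_apply)
  qed
  then show False using f by blast
qed

section \<open>Discharging\<close>

lemma bad_V: "bad v \<Longrightarrow> v \<in> V" and bad_deg: "bad v \<Longrightarrow> deg v = 3"
  by (simp_all add: bad_def)

lemma bad_obtain:
  assumes "bad v"
  obtains u p q where "N v = {u, p, q}" "u \<noteq> p" "u \<noteq> q" "p \<noteq> q" "deg u = 2" "deg p \<noteq> 2" "deg q \<noteq> 2"
proof -
  have v: "v \<in> V" "deg v = 3" using assms bad_V bad_deg by simp_all
  obtain u where u: "u \<in> N v" "deg u = 2" using assms unfolding bad_def by blast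
  obtain p q where pq: "N v = {u, p, q}" "u \<noteq> p" "u \<noteq> q" "p \<noteq> q" using deg3_obtain[OF v u(1)] .
  have "deg p \<noteq> 2" "deg q \<noteq> 2"
    using three_vertex_2_nbr_unique[OF v u, of p] three_vertex_2_nbr_unique[OF v u, of q] pq by auto
  then show ?thesis using that[OF pq u(2)] by simp
qed

text \<open>The vertex \<open>v\<close> sends to its neighbour \<open>u\<close>. A 2-vertex has charge -8 and is supplied from both
  sides; a bad vertex is left with -1 after paying its 2-neighbour.\<close>

definition transfer :: "'a \<Rightarrow> 'a \<Rightarrow> int" where
  "transfer v u = (if deg u = 2 then 4 else if bad u \<and> \<not> bad v \<and> deg v \<noteq> 2 then 1 else 0)"

definition final_charge :: "'a \<Rightarrow> int" where
  "final_charge v = 11 * int (deg v) - 30 - (\<Sum>u\<in>N v. transfer v u) + (\<Sum>u\<in>N v. transfer u v)"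

text \<open>Charge is only moved: what is sent along an edge in one direction is received at the other end.\<close>

lemma sum_final_charge: "(\<Sum>v\<in>V. final_charge v) = 11 * int (\<Sum>v\<in>V. deg v) - 30 * int (card V)"
proof -
  have "(\<Sum>v\<in>V. \<Sum>u\<in>N v. transfer v u) = (\<Sum>v\<in>V. \<Sum>u\<in>{u \<in> V. {u, v} \<in> E}. transfer v u)"
    by (simp add: nbrs_def)
  also have "\<dots> = (\<Sum>u\<in>V. \<Sum>v\<in>{v \<in> V. {u, v} \<in> E}. transfer v u)"
    by (rule sum.swap_restrict[OF finite_V finite_V])
  also have "\<dots> = (\<Sum>u\<in>V. \<Sum>v\<in>N u. transfer v u)"
    by (simp add: nbrs_def insert_commute)
  finally have sw: "(\<Sum>v\<in>V. \<Sum>u\<in>N v. transfer v u) = (\<Sum>u\<in>V. \<Sum>v\<in>N u. transfer v u)" .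
  show ?thesis
    unfolding final_charge_def
    by (simp add: sum.distrib sum_subtractf sw sum_distrib_left)
qed

lemma final_charge_2:
  assumes v: "v \<in> V" "deg v = 2" shows "final_charge v = 0"
proof -
  have "transfer v u = 0" if "u \<in> N v" for u
    using no_adjacent_2_vertices[OF v that] v(2) by (simp add: transfer_def)
  then have "(\<Sum>u\<in>N v. transfer v u) = 0" by simp
  moreover have "(\<Sum>u\<in>N v. transfer u v) = 8"
    using v(2) by (simp add: transfer_def degree_def)
  ultimately show ?thesis using v(2) by (simp add: final_charge_def)
qed

text \<open>The charge 3 of a bad vertex falls to -1 at its 2-neighbour and is restored by a neighbour that is
  neither bad nor of degree 2; there is one by \<open>no_bad_path\<close>.\<close>

lemma final_charge_bad:
  assumes "bad v"
  shows "final_charge v \<ge> 0"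
    and "final_charge v = 0 \<Longrightarrow> \<exists>u p q. N v = {u, p, q} \<and> u \<noteq> p \<and> u \<noteq> q \<and> p \<noteq> q \<and> deg u = 2 \<and> bad p \<and> \<not> bad q \<and> deg q \<noteq> 2"
proof -
  obtain u p q where N: "N v = {u, p, q}" and ne: "u \<noteq> p" "u \<noteq> q" "p \<noteq> q"
    and d: "deg u = 2" "deg p \<noteq> 2" "deg q \<noteq> 2" using bad_obtain[OF assms] .
  have nb: "\<not> bad p \<or> \<not> bad q" using no_bad_path[OF assms, of p q] N ne by blast
  have dv: "deg v = 3" by (rule bad_deg[OF assms])
  have "(\<Sum>w\<in>N v. transfer v w) = 4"
    unfolding N using ne d assms by (simp add: transfer_def)
  moreover have "(\<Sum>w\<in>N v. transfer w v) = of_bool (\<not> bad p) + of_bool (\<not> bad q)"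
    unfolding N using ne d assms dv by (simp add: transfer_def)
  ultimately have c: "final_charge v = of_bool (\<not> bad p) + of_bool (\<not> bad q) - 1"
    using dv by (simp add: final_charge_def)
  show "final_charge v \<ge> 0" using c nb by auto
  assume "final_charge v = 0"
  then consider "bad p" "\<not> bad q" | "bad q" "\<not> bad p" using c by (auto simp: of_bool_def split: if_splits)
  then show "\<exists>u p q. N v = {u, p, q} \<and> u \<noteq> p \<and> u \<noteq> q \<and> p \<noteq> q \<and> deg u = 2 \<and> bad p \<and> \<not> bad q \<and> deg q \<noteq> 2"
  proof cases
    case 1 show ?thesis by (rule exI[of _ u], rule exI[of _ p], rule exI[of _ q]) (use 1 N ne d in simp)
  next
    case 2 show ?thesis by (rule exI[of _ u], rule exI[of _ q], rule exI[of _ p]) (use 2 N ne d in \<open>simp add: insert_commute\<close>)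
  qed
qed

text \<open>A 3-vertex without 2-neighbours has charge 3 and spends 1 on each bad neighbour.\<close>

lemma final_charge_good_3:
  assumes v: "v \<in> V" "deg v = 3" "\<not> bad v"
  shows "final_charge v \<ge> 0" and "final_charge v = 0 \<Longrightarrow> u \<in> N v \<Longrightarrow> bad u"
proof -
  have d: "deg u \<noteq> 2" if "u \<in> N v" for u using v that by (auto simp: bad_def)
  have "(\<Sum>u\<in>N v. transfer u v) = 0" using v by (simp add: transfer_def)
  moreover have t: "transfer v u = of_bool (bad u)" if "u \<in> N v" for u
    using d[OF that] v by (simp add: transfer_def)
  ultimately have "final_charge v = 3 - (\<Sum>u\<in>N v. of_bool (bad u))"
    using v by (simp add: final_charge_def)
  moreover have "int (deg v) = (\<Sum>u\<in>N v. 1)" by (simp add: degree_def)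
  ultimately have c: "final_charge v = (\<Sum>u\<in>N v. of_bool (\<not> bad u))"
    using v(2) by (simp add: of_bool_not_iff sum_subtractf)
  show "final_charge v \<ge> 0" unfolding c by (rule sum_nonneg) simp
  assume z: "final_charge v = 0" and u: "u \<in> N v"
  have "\<forall>u\<in>N v. of_bool (\<not> bad u) = (0::int)"
    using z unfolding c by (subst (asm) sum_nonneg_eq_0_iff) simp_all
  then show "bad u" using u by simp
qed

text \<open>Sending 4 to each neighbour is affordable from degree 5 on. At degree 4 the charge is 14, and at most
  three neighbours have degree 2.\<close>

lemma final_charge_large:
  assumes v: "v \<in> V" "deg v \<ge> 4"
  shows "final_charge v > 0"
proof -
  have le4: "transfer v u \<le> 4" for u by (simp add: transfer_def)
  have ge: "(\<Sum>u\<in>N v. transfer u v) \<ge> 0" by (rule sum_nonneg) (simp add: transfer_def)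
  show ?thesis
  proof (cases "deg v = 4")
    case True
    obtain w where w: "w \<in> N v" "deg w \<noteq> 2" using four_vertex_all_2_nbrs[OF v(1) True] by blast
    have "(\<Sum>u\<in>N v - {w}. transfer v u) \<le> of_nat (card (N v - {w})) * 4"
      by (rule sum_bounded_above) (rule le4)
    moreover have "card (N v - {w}) = 3" using w(1) True by (simp add: degree_def)
    moreover have "(\<Sum>u\<in>N v. transfer v u) = transfer v w + (\<Sum>u\<in>N v - {w}. transfer v u)"
      by (rule sum.remove) (use w in simp_all)
    moreover have "transfer v w \<le> 1" using w(2) by (simp add: transfer_def)
    ultimately show ?thesis using ge True by (simp add: final_charge_def)
  next
    case False
    have "(\<Sum>u\<in>N v. transfer v u) \<le> of_nat (card (N v)) * 4"
      by (rule sum_bounded_above) (rule le4)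
    then show ?thesis using ge False v(2) by (simp add: final_charge_def degree_def)
  qed
qed

lemma final_charge_nonneg: assumes v: "v \<in> V" shows "final_charge v \<ge> 0"
proof -
  consider "deg v = 2" | "bad v" | "deg v = 3" "\<not> bad v" | "deg v \<ge> 4" using min_degree[OF v] by linarith
  then show ?thesis
    by cases (use final_charge_2 final_charge_bad final_charge_good_3 final_charge_large v in force)+
qed

lemma final_charge_zero:
  assumes sparse: "11 * (\<Sum>v\<in>V. deg v) \<le> 30 * card V" and v: "v \<in> V"
  shows "final_charge v = 0"
proof -
  have "int (11 * (\<Sum>v\<in>V. deg v)) \<le> int (30 * card V)" using sparse by (simp only: of_nat_le_iff)
  then have "(\<Sum>v\<in>V. final_charge v) \<le> 0" unfolding sum_final_charge by simp
  moreover have "(\<Sum>v\<in>V. final_charge v) \<ge> 0" by (rule sum_nonneg) (rule final_charge_nonneg)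
  ultimately have "(\<Sum>v\<in>V. final_charge v) = 0" by simp
  then have "\<forall>v\<in>V. final_charge v = 0"
    by (subst (asm) sum_nonneg_eq_0_iff[OF finite_V final_charge_nonneg])
  then show ?thesis using v by blast
qed

end

section \<open>Graphs of average degree exactly 30/11\<close>

text \<open>The involutions \<open>s\<close> and \<open>t\<close> are two perfect matchings of \<open>B\<close>, whose union consists of even cycles.
  For the induction one \<open>s\<close>-edge \<open>ab\<close> is removed and the \<open>t\<close>-partners of its ends are matched with
  each other, so that they get different colours, which can be flipped for \<open>a\<close> and \<open>b\<close>.\<close>

lemma two_matchings_2_colorable:
  assumes "finite B"
    and "\<And>v. v \<in> B \<Longrightarrow> s v \<in> B \<and> s v \<noteq> v \<and> s (s v) = v"
    and "\<And>v. v \<in> B \<Longrightarrow> t v \<in> B \<and> t v \<noteq> v \<and> t (t v) = v"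
  shows "\<exists>x :: 'a \<Rightarrow> bool. \<forall>v\<in>B. x (s v) \<noteq> x v \<and> x (t v) \<noteq> x v"
  using assms
proof (induction "card B" arbitrary: B t rule: less_induct)
  case less
  note s = less.prems(2) and t = less.prems(3)
  show ?case
  proof (cases "B = {}")
    case False
    then obtain a where a: "a \<in> B" by blast
    define b where "b = s a"
    have b: "b \<in> B" "b \<noteq> a" "s b = a" using s[OF a] by (simp_all add: b_def)
    let ?B = "B - {a, b}"
    have small: "card ?B < card B" "finite ?B"
      using less.prems(1) a by (auto intro!: psubset_card_mono)
    have s': "s v \<in> ?B \<and> s v \<noteq> v \<and> s (s v) = v" if v: "v \<in> ?B" for v
    proof -
      have "s v \<noteq> a" "s v \<noteq> b" using s[of v] v b b_def s[OF a] by auto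
      then show ?thesis using s[of v] v by auto
    qed
    show ?thesis
    proof (cases "t a = b")
      case True
      then have tb: "t b = a" using t[OF a] by auto
      have t': "t v \<in> ?B \<and> t v \<noteq> v \<and> t (t v) = v" if v: "v \<in> ?B" for v
      proof -
        have "t v \<noteq> a" "t v \<noteq> b" using t[of v] v True tb by auto
        then show ?thesis using t[of v] v by auto
      qed
      from less.hyps[OF small s' t'] obtain x :: "'a \<Rightarrow> bool" where x: "\<forall>v\<in>?B. x (s v) \<noteq> x v \<and> x (t v) \<noteq> x v"
        by (rule exE)
      let ?x = "x(a := True, b := False)"
      have "?x (s v) \<noteq> ?x v \<and> ?x (t v) \<noteq> ?x v" if v: "v \<in> B" for v
      proof -
        consider "v = a" | "v = b" | "v \<in> ?B" using v by blast
        then show ?thesis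
        proof cases
          case 3
          have "s v \<notin> {a, b}" "t v \<notin> {a, b}"
            using s'[OF 3] t[of v] v 3 True tb by auto
          then show ?thesis using 3 x by auto
        qed (use b b_def True tb in auto)
      qed
      then show ?thesis by blast
    next
      case False
      define a' where "a' = t a"
      define b' where "b' = t b"
      have ta: "t a' = a" "a' \<in> B" "a' \<noteq> a" "a' \<noteq> b" using t[OF a] False by (simp_all add: a'_def)
      have tb: "t b' = b" "b' \<in> B" "b' \<noteq> b" using t[OF b(1)] by (simp_all add: b'_def)
      have b'a: "b' \<noteq> a" using False tb(1) by auto
      have ab': "a' \<noteq> b'" using ta(1) tb(1) b(2) by auto
      let ?t = "t(a' := b', b' := a')"
      have t': "?t v \<in> ?B \<and> ?t v \<noteq> v \<and> ?t (?t v) = v" if v: "v \<in> ?B" for v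
      proof -
        consider "v = a'" | "v = b'" | "v \<noteq> a'" "v \<noteq> b'" by blast
        then show ?thesis
        proof cases
          case 3
          have "t v \<noteq> a" "t v \<noteq> b" "t v \<noteq> a'" "t v \<noteq> b'"
            using t[of v] v 3 ta tb a'_def b'_def by auto
          then show ?thesis using t[of v] v 3 by auto
        qed (use ta tb b'a ab' in auto)
      qed
      from less.hyps[OF small s' t'] obtain x :: "'a \<Rightarrow> bool" where x: "\<forall>v\<in>?B. x (s v) \<noteq> x v \<and> x (?t v) \<noteq> x v"
        by (rule exE)
      have "a' \<in> ?B" using ta by simp
      then have xab: "x b' \<noteq> x a'" using x ab' by (metis fun_upd_other fun_upd_same)
      let ?x = "x(a := \<not> x a', b := \<not> x b')"
      have "?x (s v) \<noteq> ?x v \<and> ?x (t v) \<noteq> ?x v" if v: "v \<in> B" for v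
      proof -
        consider "v = a" | "v = b" | "v \<in> ?B" "v = a'" | "v \<in> ?B" "v = b'" | "v \<in> ?B" "v \<noteq> a'" "v \<noteq> b'" using v by blast
        then show ?thesis
        proof cases
          case 1
          then have "s v = b" "t v = a'" by (simp_all add: b_def a'_def)
          then show ?thesis using 1 ta xab b(2) by simp
        next
          case 2
          then have "s v = a" "t v = b'" using b by (simp_all add: b'_def)
          then show ?thesis using 2 tb b'a xab b(2) by simp
        next
          case 3
          have "x (s v) \<noteq> x v" "s v \<notin> {a, b}" using x s'[OF 3(1)] 3(1) by blast+
          then show ?thesis using 3 ta b(2) by simp
        next
          case 4
          have "x (s v) \<noteq> x v" "s v \<notin> {a, b}" using x s'[OF 4(1)] 4(1) by blast+
          then show ?thesis using 4 tb b'a b(2) by simp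
        next
          case 5
          have "x (s v) \<noteq> x v" "s v \<notin> {a, b}" "x (t v) \<noteq> x v" 
            using bspec[OF x 5(1)] s'[OF 5(1)] 5(2,3) by simp_all
          moreover have "t v \<noteq> a" "t v \<noteq> b"
            using t[OF v] 5 a'_def b'_def by auto
          ultimately show ?thesis using 5(1) by simp
        qed
      qed
      then show ?thesis by blast
    qed
  qed simp
qed

text \<open>A pair of bits as one of the colours 1 to 4.\<close>

definition code :: "bool \<Rightarrow> bool \<Rightarrow> nat" where
  "code p q = (if p then 1 else 3) + (if q then 1 else 0)"

lemma code_eq: "code p q = code p' q' \<longleftrightarrow> p = p' \<and> q = q'"
  by (cases p; cases q; cases p'; cases q') (simp_all add: code_def)

lemma code_range: "1 \<le> code p q" "code p q \<le> 4" "code p q \<noteq> 5" "code p q \<noteq> 6"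
  by (cases p; cases q; simp add: code_def)+

text \<open>Among three bits either all agree, and a constant second bit makes the colours equal, or exactly two
  agree, and the second bit separates them.\<close>

lemma refine_coloring_of_triple:
  assumes "card A = 3" shows "\<exists>y. odd_on (\<lambda>v. code (x v) (y v)) A"
proof -
  obtain p q r where A: "A = {p, q, r}" and ne: "p \<noteq> q" "p \<noteq> r" "q \<noteq> r"
    using assms by (auto simp: card_3_iff)
  have *: "odd_on (\<lambda>v. code (x v) (y v)) A"
    if "rainbow_or_constant (code (x p) (y p)) (code (x q) (y q)) (code (x r) (y r))" for y
    unfolding A by (rule odd_on_triple) (use ne that in simp_all)
  consider "x p = x q" "x q = x r" | "x p = x q" "x q \<noteq> x r" | "x p \<noteq> x q" "x q = x r" | "x p \<noteq> x q" "x p = x r"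
    by blast
  then show ?thesis
  proof cases
    case 1
    then show ?thesis
      by (intro exI[of _ "\<lambda>v. False"] *) (simp add: rainbow_or_constant_def code_eq)
  next
    case 2
    then show ?thesis using ne
      by (intro exI[of _ "\<lambda>v. v = p"] *) (simp add: rainbow_or_constant_def code_eq)
  next
    case 3
    then show ?thesis using ne
      by (intro exI[of _ "\<lambda>v. v = q"] *) (simp add: rainbow_or_constant_def code_eq)
  next
    case 4
    then show ?thesis using ne
      by (intro exI[of _ "\<lambda>v. v = p"] *) (simp add: rainbow_or_constant_def code_eq)
  qed
qed

context critical_graph begin

text \<open>Equality holds throughout the discharging. For a bad vertex \<open>v\<close> let \<open>two v\<close>, \<open>prt v\<close> and \<open>cen v\<close> be
  its neighbour of degree 2, its bad neighbour and its remaining neighbour, and let \<open>sib v\<close> be the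
  other neighbour of \<open>two v\<close>. Then \<open>prt\<close> and \<open>sib\<close> are involutions without fixed points on the bad
  vertices; a colouring \<open>x\<close> that is proper for both is refined around each vertex \<open>cen v\<close>.\<close>

theorem not_sparse: "\<not> 11 * (\<Sum>v\<in>V. deg v) \<le> 30 * card V"
proof
  assume sparse: "11 * (\<Sum>v\<in>V. deg v) \<le> 30 * card V"
  note zero = final_charge_zero[OF sparse]
  have d23: "deg v = 2 \<or> deg v = 3" if v: "v \<in> V" for v
    using min_degree[OF v] final_charge_large[OF v] zero[OF v] by linarith
  have "\<exists>u p q. bad v \<longrightarrow> N v = {u, p, q} \<and> u \<noteq> p \<and> u \<noteq> q \<and> p \<noteq> q \<and> deg u = 2 \<and> bad p \<and> \<not> bad q \<and> deg q \<noteq> 2" for v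
    using final_charge_bad(2)[of v] zero[of v] bad_V[of v] by blast
  then obtain two prt cen where st: "\<And>v. bad v \<Longrightarrow> N v = {two v, prt v, cen v} \<and> two v \<noteq> prt v \<and> two v \<noteq> cen v \<and> prt v \<noteq> cen v
      \<and> deg (two v) = 2 \<and> bad (prt v) \<and> \<not> bad (cen v) \<and> deg (cen v) \<noteq> 2"
    by metis
  have good: "bad u" if "v \<in> V" "deg v = 3" "\<not> bad v" "u \<in> N v" for u v
    using final_charge_good_3(2)[OF that(1-3) zero[OF that(1)] that(4)] .
  have two_bad: "bad u" if v: "v \<in> V" "deg v = 2" "u \<in> N v" for u v
  proof -
    have "deg u = 3" using d23[OF N_V[OF v(3)]] no_adjacent_2_vertices[OF v(1,2,3)] by blast
    then show ?thesis unfolding bad_def using N_V[OF v(3)] N_sym[OF v(1,3)] v(2) by blast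
  qed
  have prt: "bad (prt v) \<and> prt v \<noteq> v \<and> prt (prt v) = v" if b: "bad v" for v
  proof -
    have p: "bad (prt v)" "prt v \<in> N v" using st[OF b] by auto
    have "v \<in> N (prt v)" by (rule N_sym[OF bad_V[OF b] p(2)])
    then have "v = two (prt v) \<or> v = prt (prt v) \<or> v = cen (prt v)" using st[OF p(1)] by simp
    then have "prt (prt v) = v" using st[OF p(1)] b bad_deg[OF b] by auto
    then show ?thesis using p N_ne[OF p(2)] by simp
  qed
  have "\<exists>w. bad v \<longrightarrow> N (two v) = {v, w} \<and> v \<noteq> w" for v
  proof (cases "bad v")
    case True
    then have t: "two v \<in> N v" "deg (two v) = 2" using st by auto
    obtain w where "N (two v) = {v, w}" "v \<noteq> w"
      using deg2_obtain[OF N_V[OF t(1)] t(2) N_sym[OF bad_V[OF True] t(1)]] .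
    then show ?thesis by blast
  qed blast
  then obtain sib where sib': "\<And>v. bad v \<Longrightarrow> N (two v) = {v, sib v} \<and> v \<noteq> sib v" by metis
  have two_sib: "bad (sib v) \<and> two (sib v) = two v" if b: "bad v" for v
  proof -
    have t: "two v \<in> N v" "deg (two v) = 2" using st[OF b] by auto
    have tV: "two v \<in> V" by (rule N_V[OF t(1)])
    have sN: "sib v \<in> N (two v)" using sib'[OF b] by simp
    have bs: "bad (sib v)" by (rule two_bad[OF tV t(2) sN])
    have "two (sib v) \<in> N (sib v)" "deg (two (sib v)) = 2" using st[OF bs] by auto
    then have "two (sib v) = two v"
      using three_vertex_2_nbr_unique[OF bad_V[OF bs] bad_deg[OF bs] _ _ N_sym[OF tV sN] t(2)] by blast
    then show ?thesis using bs by simp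
  qed
  have sib: "bad (sib v) \<and> sib v \<noteq> v \<and> sib (sib v) = v" if b: "bad v" for v
  proof -
    have "bad (sib v)" and e: "two (sib v) = two v" using two_sib[OF b] by auto
    then have "{sib v, sib (sib v)} = {v, sib v}" "sib v \<noteq> sib (sib v)"
      using sib'[of "sib v"] sib'[OF b] by auto
    then have "sib (sib v) = v" unfolding doubleton_eq_iff by simp
    then show ?thesis using sib'[OF b] \<open>bad (sib v)\<close> by auto
  qed
  have "finite {v. bad v}" by (rule finite_subset[OF _ finite_V]) (use bad_V in blast)
  then obtain x :: "'a \<Rightarrow> bool" where x: "\<And>v. bad v \<Longrightarrow> x (sib v) \<noteq> x v \<and> x (prt v) \<noteq> x v"
    using two_matchings_2_colorable[of "{v. bad v}" sib prt] sib prt by auto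
  have "\<exists>y. deg v = 3 \<longrightarrow> odd_on (\<lambda>w. code (x w) (y w)) (N v)" for v
    using refine_coloring_of_triple[of "N v" x] by (auto simp: degree_def)
  then obtain Y where Y: "\<And>v. deg v = 3 \<Longrightarrow> odd_on (\<lambda>w. code (x w) (Y v w)) (N v)" by metis
  define h where "h v = (if deg v = 2 then 5 else if bad v then code (x v) (Y (cen v) v) else 6)" for v
  have h2: "h v = 5" if "deg v = 2" for v using that by (simp add: h_def)
  have hb: "h v = code (x v) (Y (cen v) v)" if "bad v" for v using that bad_deg[OF that] by (simp add: h_def)
  have hg: "h v = 6" if "\<not> bad v" "deg v \<noteq> 2" for v using that by (simp add: h_def)
  have hprt: "h (prt v) \<noteq> h v" "h (sib v) \<noteq> h v" if b: "bad v" for v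
    using x[OF b] prt[OF b] sib[OF b] b by (simp_all add: hb code_eq)
  have proper: "h u \<noteq> h v" if v: "v \<in> V" and u: "u \<in> N v" for u v
  proof -
    consider "deg v = 2" | "bad v" | "deg v = 3" "\<not> bad v" using d23[OF v] by blast
    then show ?thesis
    proof cases
      case 1 then show ?thesis using two_bad[OF v 1 u] by (simp add: h2 hb code_range)
    next
      case 2
      then have "u = two v \<or> u = prt v \<or> u = cen v" using st[OF 2] u by simp
      then show ?thesis
        using st[OF 2] hprt[OF 2] code_range(3,4)[of "x v" "Y (cen v) v"] by (elim disjE) (auto simp: h2 hb[OF 2] hg)
    next
      case 3 then show ?thesis using good[OF v 3 u] by (simp add: hg hb code_range)
    qed
  qed
  have odd: "odd_on h (N v)" if v: "v \<in> V" for v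
  proof -
    consider "deg v = 2" | "bad v" | "deg v = 3" "\<not> bad v" using d23[OF v] by blast
    then show ?thesis
    proof cases
      case 1
      obtain w where w: "w \<in> N v" using 1 by (fastforce simp: degree_def)
      have bw: "bad w" by (rule two_bad[OF v 1 w])
      have "two w = v"
        using three_vertex_2_nbr_unique[OF bad_V[OF bw] bad_deg[OF bw] _ _ N_sym[OF v w] 1] st[OF bw] by blast
      then have "N v = {w, sib w}" using sib'[OF bw] by simp
      then show ?thesis using hprt(2)[OF bw] odd_on_doubleton[of h w "sib w"] by simp
    next
      case 2
      have "h (two v) = 5" "h (prt v) = code (x (prt v)) (Y (cen (prt v)) (prt v))" "h (cen v) = 6"
        using st[OF 2] h2 hb hg by auto
      then have "rainbow_or_constant (h (two v)) (h (prt v)) (h (cen v))"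
        using code_range(3,4)[of "x (prt v)" "Y (cen (prt v)) (prt v)"] by (auto simp: rainbow_or_constant_def)
      then show ?thesis using st[OF 2] odd_on_triple[of "two v" "prt v" "cen v" h] by simp
    next
      case 3
      have "h w = code (x w) (Y v w)" if w: "w \<in> N v" for w
      proof -
        have bw: "bad w" by (rule good[OF v 3 w])
        have "v = two w \<or> v = prt w \<or> v = cen w" using N_sym[OF v w] st[OF bw] by simp
        then have "cen w = v" using st[OF bw] 3 by auto
        then show ?thesis using hb[OF bw] by simp
      qed
      then show ?thesis using Y[OF 3(1)] odd_on_cong[of "N v" h "\<lambda>w. code (x w) (Y v w)"] by simp
    qed
  qed
  have "h ` V \<subseteq> colors"
  proof -
    have "D \<ge> 3" if v: "v \<in> V" for v
    proof (cases "deg v = 2")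
      case True
      then obtain w where w: "w \<in> N v" by (fastforce simp: degree_def)
      then show ?thesis using bad_deg[OF two_bad[OF v True w]] degree_le[OF N_V[OF w]] by simp
    next
      case False
      then show ?thesis using d23[OF v] degree_le[OF v] by simp
    qed
    moreover have "1 \<le> h v \<and> h v \<le> 6" for v using code_range(1,2)[of "x v" "Y (cen v) v"] by (simp add: h_def)
    ultimately show ?thesis by fastforce
  qed
  then have "strong_odd_coloring V E (D + 3) h"
    unfolding strong_odd_coloring_def proper_coloring_def
    using proper odd by (auto simp: odd_on_def nbrs_def)
  then show False using not_colorable by blast
qed

end

section \<open>Sparsity of induced subgraphs and the bound\<close>

lemma sum_degrees:
  assumes "finite W" "\<And>e. e \<in> E \<Longrightarrow> card e = 2"
  shows "(\<Sum>v\<in>W. degree W E v) = 2 * card {e \<in> E. e \<subseteq> W}"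
proof -
  let ?F = "{e \<in> E. e \<subseteq> W}"
  have fF: "finite ?F" by (rule finite_subset[of _ "Pow W"]) (use assms(1) in auto)
  have "degree W E v = card {e \<in> ?F. v \<in> e}" if v: "v \<in> W" for v
  proof -
    have "bij_betw (\<lambda>u. {u, v}) (nbrs W E v) {e \<in> ?F. v \<in> e}"
      unfolding bij_betw_def
    proof
      show "inj_on (\<lambda>u. {u, v}) (nbrs W E v)" by (auto simp: inj_on_def doubleton_eq_iff)
      show "(\<lambda>u. {u, v}) ` nbrs W E v = {e \<in> ?F. v \<in> e}"
      proof (intro equalityI subsetI)
        fix e assume "e \<in> (\<lambda>u. {u, v}) ` nbrs W E v"
        then show "e \<in> {e \<in> ?F. v \<in> e}" using v by (auto simp: nbrs_def)
      next
        fix e assume e: "e \<in> {e \<in> ?F. v \<in> e}"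
        then have "card e = 2" using assms(2) by blast
        then obtain u where u: "e = {v, u}" "v \<noteq> u" using card2_obtain[of e v] e by blast
        then have "u \<in> nbrs W E v" using e by (auto simp: nbrs_def insert_commute)
        then show "e \<in> (\<lambda>u. {u, v}) ` nbrs W E v" using u(1) by (intro image_eqI[of _ _ u]) (auto simp: insert_commute)
      qed
    qed
    then show ?thesis unfolding degree_def by (rule bij_betw_same_card)
  qed
  then have "(\<Sum>v\<in>W. degree W E v) = (\<Sum>v\<in>W. card {e \<in> ?F. v \<in> e})" by simp
  also have "\<dots> = (\<Sum>e\<in>?F. 2)"
  proof (rule sum_multicount_gen[OF assms(1) fF])
    show "\<forall>e\<in>?F. card {v \<in> W. v \<in> e} = 2"
    proof
      fix e assume e: "e \<in> ?F"
      then have "{v \<in> W. v \<in> e} = e" by blast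
      then show "card {v \<in> W. v \<in> e} = 2" using assms(2) e by simp
    qed
  qed
  finally show ?thesis by simp
qed

text \<open>The edges of \<open>E\<close> inside \<open>W\<close> give a subgraph that competes in the maximum defining \<open>mad\<close>.\<close>

lemma average_degree_le_mad:
  assumes G: "simple_graph V E" and W: "W \<subseteq> V" "W \<noteq> {}"
  shows "real (\<Sum>v\<in>W. degree W E v) / real (card W) \<le> mad V E"
proof -
  let ?X = "{2 * real (card F) / real (card W) | W F. subgraph W F V E \<and> W \<noteq> {}}"
  let ?F = "{e \<in> E. e \<subseteq> W}"
  have fV: "finite V" and E: "\<And>e. e \<in> E \<Longrightarrow> e \<subseteq> V \<and> card e = 2" using G by (auto simp: simple_graph_def)
  have fW: "finite W" using finite_subset[OF W(1) fV] .
  have fE: "finite E" by (rule finite_subset[of _ "Pow V"]) (use fV E in auto)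
  have "?X \<subseteq> (\<lambda>(W, F). 2 * real (card F) / real (card W)) ` (Pow V \<times> Pow E)"
    by (force simp: subgraph_def)
  then have fX: "finite ?X" by (rule finite_subset) (use fV fE in simp)
  have "subgraph W ?F V E" using W fW E by (auto simp: subgraph_def simple_graph_def)
  then have "2 * real (card ?F) / real (card W) \<in> ?X" using W(2) by blast
  then have "2 * real (card ?F) / real (card W) \<le> mad V E"
    unfolding mad_def using fX by (intro Max_ge) auto
  then show ?thesis using sum_degrees[OF fW, of E] E by simp
qed

text \<open>Induction on the vertex set: a smallest induced subgraph without a colouring would be a critical
  graph that is sparse.\<close>

theorem theorem1p3:
  fixes V :: "'a set" and E :: "'a set set"
  assumes "simple_graph V E"
    and "C4_free V E"
    and "mad V E \<le> 30 / 11"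
  shows "strong_odd_chromatic_number V E \<le> max_degree V E + 3"
proof -
  let ?D = "max_degree V E"
  have fV: "finite V" and E: "\<And>e. e \<in> E \<Longrightarrow> card e = 2" using assms(1) by (auto simp: simple_graph_def)
  have deg_mono: "degree W E v \<le> degree V E v" if "W \<subseteq> V" for W v
    unfolding degree_def by (rule card_mono) (use fV that in \<open>auto simp: nbrs_def\<close>)
  have "\<exists>f. strong_odd_coloring W E (?D + 3) f" if "W \<subseteq> V" for W
    using that
  proof (induction "card W" arbitrary: W rule: less_induct)
    case less
    have fW: "finite W" using finite_subset[OF less.prems fV] .
    show ?case
    proof (rule ccontr)
      assume no: "\<nexists>f. strong_odd_coloring W E (?D + 3) f"
      interpret critical_graph W E ?D
      proof
        show "C4_free W E" using assms(2) less.prems unfolding C4_free_def by blast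
        show "degree W E v \<le> ?D" if "v \<in> W" for v
        proof -
          have "degree V E v \<le> ?D" unfolding max_degree_def using fV that less.prems by (intro Max_ge) auto
          then show ?thesis using deg_mono[OF less.prems, of v] by simp
        qed
        show "\<exists>f. strong_odd_coloring U E (?D + 3) f" if "U \<subset> W" for U
          using less.hyps[of U] psubset_card_mono[OF fW that] that less.prems by blast
      qed (use fW E no in auto)
      have "W \<noteq> {}"
      proof
        assume "W = {}"
        then have "strong_odd_coloring W E (?D + 3) (\<lambda>_. 1)"
          by (simp add: strong_odd_coloring_def proper_coloring_def)
        then show False using no by blast
      qed
      then have "real (\<Sum>v\<in>W. degree W E v) / real (card W) \<le> 30 / 11"
        using average_degree_le_mad[OF assms(1) less.prems] assms(3) by linarith
      moreover have "real (card W) > 0" using fW \<open>W \<noteq> {}\<close> by (simp add: card_gt_0_iff)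
      ultimately have "11 * real (\<Sum>v\<in>W. degree W E v) \<le> 30 * real (card W)"
        by (simp add: field_simps)
      then have "real (11 * (\<Sum>v\<in>W. degree W E v)) \<le> real (30 * card W)" by simp
      then have "11 * (\<Sum>v\<in>W. degree W E v) \<le> 30 * card W" by (simp only: of_nat_le_iff)
      then show False using not_sparse by blast
    qed
  qed
  then obtain f where "strong_odd_coloring V E (?D + 3) f" by blast
  then show ?thesis
    unfolding strong_odd_chromatic_number_def by (intro Least_le) auto
qed

end
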